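(* Let $N\ge1$ be an integer, $p>1$, $q>1$, $\alpha>0$. Assume that either $p>2$, or $p<2$ and $\alpha<\delta$, where $\delta=\frac{p}{2-p}$. Let $w$ be any solution of $$(|w'|^{p-2}w')'+\frac{N-1}{r}|w'|^{p-2}w'+rw'+\alpha w+|w|^{q-1}w=0\qquad (E)$$ such that $\lim_{r\to\infty}r^\alpha w(r)=0$. (i) If $p>2$, then $w$ has a compact support, i.e. $w(r)=0$ for all sufficiently large $r$. (ii) If $p<2$, then $w(r)=O(r^{-\delta})$ near $\infty$.
   Context: A solution of (E) is a function $w\in C^1((R_w,\infty))$, for some $R_w\ge0$, with $|w'|^{p-2}w'\in C^1((R_w,\infty))$, satisfying (E) on $(R_w,\infty)$. *)

theory Defs
  imports "HOL-Analysis.Analysis" "HOL-Library.Landau_Symbols"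
begin

text \<open>
  The function \<open>\<bar>w'\<bar>\<^sup>p\<^sup>-\<^sup>2 w'\<close>. Where \<open>w'\<close> vanishes the value is \<open>0\<close>, also for
  \<open>1 < p < 2\<close>, which is the usual continuous extension of \<open>\<bar>x\<bar>\<^sup>p\<^sup>-\<^sup>2 x\<close>.
\<close>
definition p_flux :: "real \<Rightarrow> (real \<Rightarrow> real) \<Rightarrow> real \<Rightarrow> real" where
  "p_flux p w r = \<bar>deriv w r\<bar> powr (p - 2) * deriv w r"

definition ode_E :: "nat \<Rightarrow> real \<Rightarrow> real \<Rightarrow> real \<Rightarrow> (real \<Rightarrow> real) \<Rightarrow> real \<Rightarrow> bool" where
  "ode_E N p q \<alpha> w r \<longleftrightarrow>
     deriv (p_flux p w) r + (real N - 1) / r * p_flux p w r + r * deriv w r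
       + \<alpha> * w r + \<bar>w r\<bar> powr (q - 1) * w r = 0"

text \<open>
  A solution lives on some \<open>(R, \<infinity>)\<close> with \<open>R \<ge> 0\<close>; it is represented by a total function
  whose values on \<open>(-\<infinity>, R]\<close> are irrelevant.
\<close>
definition solution_E :: "nat \<Rightarrow> real \<Rightarrow> real \<Rightarrow> real \<Rightarrow> (real \<Rightarrow> real) \<Rightarrow> bool" where
  "solution_E N p q \<alpha> w \<longleftrightarrow>
     (\<exists>R\<ge>0. w C1_differentiable_on {R<..} \<and>
            p_flux p w C1_differentiable_on {R<..} \<and>
            (\<forall>r>R. ode_E N p q \<alpha> w r))"

definition delta :: "real \<Rightarrow> real" where
  "delta p = p / (2 - p)"

end

theory Submission
  imports Defs
begin

text \<open>
  Let \<open>\<phi> = \<bar>w'\<bar>\<^sup>p\<^sup>-\<^sup>2 w'\<close>. If \<open>w = O(r\<^sup>-\<^sup>\<sigma>)\<close>, the damping term \<open>r w'\<close> forces \<open>\<phi> = O(r\<^sup>-\<^sup>k)\<close> with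
  \<open>k = (\<sigma> + 1)(p - 1)\<close>. The function \<open>J = r\<^sup>\<alpha> (w + \<phi> / r)\<close> tends to \<open>0\<close> and \<open>J'\<close> contains only \<open>\<phi>\<close> and
  \<open>\<bar>w\<bar>\<^sup>q\<^sup>-\<^sup>1 w\<close>, so integrating from infinity improves the decay of \<open>w\<close> to \<open>O(r\<^sup>-\<^sup>k\<^sup>-\<^sup>1 + r\<^sup>-\<^sup>q\<^sup>\<sigma>)\<close>.
  Iterating gives every rate below \<open>\<delta>\<close> if \<open>p < 2\<close>, and every rate if \<open>p > 2\<close>. For \<open>p < 2\<close> the constants
  stay bounded as the rate tends to \<open>\<delta>\<close>. For \<open>p > 2\<close> the energy \<open>E\<close> is eventually dominated by
  \<open>\<bar>w'\<bar>\<^sup>p\<close>, whence \<open>E' \<le> - r w'\<^sup>2 \<le> - c E\<^bsup>2/p\<^esup>\<close>, and \<open>2 / p < 1\<close> forces \<open>E\<close> to vanish in finite time.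
\<close>

subsection \<open>Differential inequalities\<close>

text \<open>To the right of the last point \<open>s\<close> before \<open>b\<close> with
  \<open>h s \<le> 0\<close>, the function is positive, so its derivative is nonpositive there, and
  the mean value theorem forbids a rise to \<open>h b > 0\<close>.\<close>

lemma nonpos_of_deriv_nonpos_where_pos:
  fixes h h' :: "real \<Rightarrow> real"
  assumes der: "\<And>r. r \<ge> a \<Longrightarrow> (h has_real_derivative h' r) (at r)"
    and le: "\<And>r. r \<ge> a \<Longrightarrow> h r > 0 \<Longrightarrow> h' r \<le> 0"
    and init: "h a \<le> 0" and b: "b \<ge> a"
  shows "h b \<le> 0"
proof (rule ccontr)
  assume "\<not> h b \<le> 0"
  then have pos: "h b > 0" by simp
  have cont: "continuous_on {a..b} h"
    by (meson DERIV_continuous_on DERIV_subset atLeastAtMost_iff der subset_UNIV)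
  define Z where "Z = {x \<in> {a..b}. h x \<le> 0}"
  have "closed Z"
    unfolding Z_def using continuous_closed_preimage[OF cont, of "{..0}"]
    by (auto simp: vimage_def Int_def)
  moreover have "Z \<noteq> {}" using init b by (auto simp: Z_def)
  moreover have bdd: "bdd_above Z" by (auto simp: Z_def bdd_above_def)
  ultimately have S: "Sup Z \<in> Z" by (simp add: closed_contains_Sup)
  define s where "s = Sup Z"
  have s: "a \<le> s" "s \<le> b" "h s \<le> 0" using S by (auto simp: Z_def s_def)
  have "s < b" using s pos by (cases "s = b") auto
  have gt: "h x > 0" if "s < x" "x \<le> b" for x
  proof (rule ccontr)
    assume "\<not> h x > 0"
    then have "x \<in> Z" using that s by (auto simp: Z_def)
    then have "x \<le> s" unfolding s_def using bdd by (rule cSup_upper)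
    then show False using that by simp
  qed
  obtain z where z: "s < z" "z < b" "h b - h s = (b - s) * h' z"
    using MVT2[OF \<open>s < b\<close>, of h h'] der s by auto
  have "h' z \<le> 0" using le[of z] gt[of z] z s by auto
  then have "h b - h s \<le> 0" using z \<open>s < b\<close> by (simp add: mult_nonneg_nonpos)
  then show False using pos s by simp
qed

text \<open>The power \<open>f powr (1 - \<gamma>)\<close> falls at least at the constant rate
  \<open>(1 - \<gamma>) * c\<close>, so it would become negative in finite time. This serves twice:
  to force entry below a barrier, and to extinguish the energy.\<close>

lemma no_positive_solution_of_sublinear_decay:
  fixes f f' :: "real \<Rightarrow> real"
  assumes der: "\<And>r. r \<ge> a \<Longrightarrow> (f has_real_derivative f' r) (at r)"
    and pos: "\<And>r. r \<ge> a \<Longrightarrow> f r > 0"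
    and le: "\<And>r. r \<ge> a \<Longrightarrow> f' r \<le> - c * f r powr \<gamma>"
    and c: "c > 0" and g: "\<gamma> < 1"
  shows False
proof -
  define g where "g = (\<lambda>r. f r powr (1 - \<gamma>))"
  define g' where "g' = (\<lambda>r. (1 - \<gamma>) * f r powr (- \<gamma>) * f' r)"
  have dg: "(g has_real_derivative g' r) (at r)" if "r \<ge> a" for r
    unfolding g_def g'_def using pos[OF that]
    by (auto intro!: derivative_eq_intros der[OF that])
  have g'_le: "g' r \<le> - ((1 - \<gamma>) * c)" if "r \<ge> a" for r
  proof -
    have "g' r \<le> (1 - \<gamma>) * f r powr (- \<gamma>) * (- c * f r powr \<gamma>)"
      unfolding g'_def using le[OF that] g by (intro mult_left_mono) auto
    also have "\<dots> = - ((1 - \<gamma>) * c)"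
      using pos[OF that] by (simp add: powr_minus field_simps)
    finally show ?thesis .
  qed
  \<comment> \<open>The line of slope \<open>- ((1 - \<gamma>) * c)\<close> through
    \<open>g a\<close> reaches zero at \<open>b - 1\<close>; the extra unit makes the bound on
    \<open>g b\<close> strictly negative.\<close>
  define b where "b = a + 1 + g a / ((1 - \<gamma>) * c)"
  have cc: "(1 - \<gamma>) * c > 0" using c g by simp
  have ga: "g a \<ge> 0" by (simp add: g_def)
  then have ab: "a < b" unfolding b_def using cc by (simp add: add_pos_nonneg)
  obtain z where z: "a < z" "z < b" "g b - g a = (b - a) * g' z"
    using MVT2[OF ab, of g g'] dg by auto
  have "(b - a) * g' z \<le> (b - a) * - ((1 - \<gamma>) * c)"
    using g'_le[of z] z ab by (intro mult_left_mono) auto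
  also have "\<dots> = - ((1 - \<gamma>) * c) - g a" 
  proof -
    have "(b - a) * d = d + g a" if "d > 0" "b = a + 1 + g a / d" for d
      using that by (simp add: field_simps)
    from this[OF cc] show ?thesis by (simp add: b_def)
  qed
  finally have "g b \<le> - ((1 - \<gamma>) * c)" using z by simp
  moreover have "g b \<ge> 0" by (simp add: g_def)
  ultimately show False using cc by simp
qed

lemma nonneg_of_antimono_tendsto_0:
  fixes h h' :: "real \<Rightarrow> real"
  assumes der: "\<And>s. s \<ge> r \<Longrightarrow> (h has_real_derivative h' s) (at s)"
    and le: "\<And>s. s \<ge> r \<Longrightarrow> h' s \<le> 0" and lim: "(h \<longlongrightarrow> 0) at_top"
  shows "h r \<ge> 0"
proof (rule tendsto_upperbound[OF lim])
  show "\<forall>\<^sub>F s in at_top. h s \<le> h r"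
  proof (rule eventually_at_top_linorderI[of r])
    fix s assume "r \<le> s"
    then show "h s \<le> h r"
      by (rule DERIV_nonpos_imp_nonincreasing) (meson der le)
  qed
qed simp

lemma tendsto_mult_powr_neg:
  fixes a b :: real
  assumes "b > 0"
  shows "((\<lambda>r. a * r powr (- b)) \<longlongrightarrow> 0) at_top"
proof -
  have "((\<lambda>r::real. r powr (- b)) \<longlongrightarrow> 0) at_top"
    by (rule tendsto_neg_powr[OF _ filterlim_ident]) (use assms in simp)
  from tendsto_mult_left[OF this, of a] show ?thesis by simp
qed

lemma has_real_derivative_mult_powr_neg:
  fixes a b r :: real
  assumes "b > 0" and "r > 0"
  shows "((\<lambda>r. a / b * r powr (- b)) has_real_derivative - (a * r powr (- b - 1))) (at r)"
  using assms by (auto intro!: derivative_eq_intros)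

text \<open>Takes the place of integration from infinity: \<open>- h\<close> is a primitive of the
  bound \<open>h'\<close>, and both \<open>h + f\<close> and \<open>h - f\<close> are nonincreasing
  with limit 0, hence nonnegative.\<close>

lemma abs_le_of_abs_deriv_le:
  fixes f f' h h' :: "real \<Rightarrow> real"
  assumes df: "\<And>s. s \<ge> r \<Longrightarrow> (f has_real_derivative f' s) (at s)"
    and dh: "\<And>s. s \<ge> r \<Longrightarrow> (h has_real_derivative - h' s) (at s)"
    and le: "\<And>s. s \<ge> r \<Longrightarrow> \<bar>f' s\<bar> \<le> h' s"
    and f0: "(f \<longlongrightarrow> 0) at_top" and h0: "(h \<longlongrightarrow> 0) at_top"
  shows "\<bar>f r\<bar> \<le> h r"
proof -
  have "h r + f r \<ge> 0"
  proof (rule nonneg_of_antimono_tendsto_0[where h = "\<lambda>s. h s + f s"])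
    show "((\<lambda>s. h s + f s) has_real_derivative - h' s + f' s) (at s)" if "s \<ge> r" for s
      by (intro DERIV_add dh df that)
    show "- h' s + f' s \<le> 0" if "s \<ge> r" for s using le[OF that] by simp
    show "((\<lambda>s. h s + f s) \<longlongrightarrow> 0) at_top" using tendsto_add[OF h0 f0] by simp
  qed
  moreover have "h r - f r \<ge> 0"
  proof (rule nonneg_of_antimono_tendsto_0[where h = "\<lambda>s. h s - f s"])
    show "((\<lambda>s. h s - f s) has_real_derivative - h' s - f' s) (at s)" if "s \<ge> r" for s
      by (intro DERIV_diff dh df that)
    show "- h' s - f' s \<le> 0" if "s \<ge> r" for s using le[OF that] by simp
    show "((\<lambda>s. h s - f s) \<longlongrightarrow> 0) at_top" using tendsto_diff[OF h0 f0] by simp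
  qed
  ultimately show ?thesis by linarith
qed

text \<open>The factor \<open>sgn x\<close> treats both signs and the origin at once; at 0 the
  difference quotient has modulus \<open>\<bar>h\<bar> powr (a - 1)\<close>, which tends to 0
  because \<open>a > 1\<close>.\<close>

lemma has_real_derivative_abs_powr:
  fixes x a :: real
  assumes "a > 1"
  shows "((\<lambda>x. \<bar>x\<bar> powr a) has_real_derivative a * (sgn x * \<bar>x\<bar> powr (a - 1))) (at x)"
proof -
  consider "x > 0" | "x < 0" | "x = 0" by linarith
  then show ?thesis
  proof cases
    case 1
    have "((\<lambda>x. x powr a) has_real_derivative a * (sgn x * \<bar>x\<bar> powr (a - 1))) (at x)"
      using 1 by (auto intro!: derivative_eq_intros)
    then show ?thesis
      by (rule has_field_derivative_transform_within_open[of _ _ _ "{0<..}"]) (use 1 in auto)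
  next
    case 2
    have "((\<lambda>x. (- x) powr a) has_real_derivative a * (sgn x * \<bar>x\<bar> powr (a - 1))) (at x)"
      using 2 by (auto intro!: derivative_eq_intros)
    then show ?thesis
      by (rule has_field_derivative_transform_within_open[of _ _ _ "{..<0}"]) (use 2 in auto)
  next
    case 3
    have "((\<lambda>h::real. \<bar>h\<bar> powr (a - 1)) \<longlongrightarrow> 0) (at 0)"
    proof (rule tendsto_zero_powrI)
      show "((\<lambda>h::real. \<bar>h\<bar>) \<longlongrightarrow> 0) (at 0)" by (rule tendsto_rabs_zero) simp
      show "((\<lambda>h::real. a - 1) \<longlongrightarrow> a - 1) (at 0)" by simp
    qed (use assms in auto)
    then have "((\<lambda>h::real. \<bar>h\<bar> powr a / h) \<longlongrightarrow> 0) (at 0)"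
    proof (rule Lim_null_comparison[rotated])
      show "\<forall>\<^sub>F h in at (0::real). norm (\<bar>h\<bar> powr a / h) \<le> \<bar>h\<bar> powr (a - 1)"
        by (auto simp: eventually_at_filter powr_diff)
    qed
    then show ?thesis using 3 assms by (simp add: DERIV_def)
  qed
qed

text \<open>Since \<open>k / (p - 1) = \<sigma> + 1\<close>, taking the root of the barrier and
  multiplying by \<open>s\<close> leaves exactly the order \<open>s powr (- \<sigma>)\<close> of the
  forcing.\<close>

lemma damping_ge_of_ge_powr:
  fixes x s p B \<sigma> k :: real
  assumes "B * s powr (- k) \<le> x" and "k = (\<sigma> + 1) * (p - 1)" and "B > 0" and "p > 1" and "s > 0"
  shows "B powr (1 / (p - 1)) * s powr (- \<sigma>) \<le> s * x powr (1 / (p - 1))"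
proof -
  have "B powr (1 / (p - 1)) * s powr (- (\<sigma> + 1)) = (B * s powr (- k)) powr (1 / (p - 1))"
    using assms by (simp add: powr_mult powr_powr)
  also have "\<dots> \<le> x powr (1 / (p - 1))"
    using assms by (intro powr_mono2) auto
  finally have "s * (B powr (1 / (p - 1)) * s powr (- (\<sigma> + 1))) \<le> s * x powr (1 / (p - 1))"
    using assms by (intro mult_left_mono) auto
  moreover have "s * s powr (- (\<sigma> + 1)) = s powr (- \<sigma>)"
    using assms powr_add[of s 1 "- (\<sigma> + 1)"] by simp
  ultimately show ?thesis by (metis mult.left_commute)
qed

text \<open>
  The barrier \<open>B r powr (- k)\<close> with \<open>k = (\<sigma> + 1) (p - 1)\<close> balances the damping
  \<open>r f powr (1 / (p - 1))\<close> against a forcing of order \<open>r powr (- \<sigma>)\<close>.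
\<close>
lemma damped_le_powr:
  fixes f f' :: "real \<Rightarrow> real"
  assumes der: "\<And>r. r \<ge> a \<Longrightarrow> (f has_real_derivative f' r) (at r)"
    and le: "\<And>r. r \<ge> a \<Longrightarrow> f r > 0 \<Longrightarrow>
               f' r \<le> - r * f r powr (1 / (p - 1)) + C * r powr (- \<sigma>)"
    and a: "a \<ge> 1" and p: "p > 1" and k: "k = (\<sigma> + 1) * (p - 1)" and B: "B > 0"
    and slow: "\<And>r. r \<ge> a \<Longrightarrow> k * B * r powr (- k - 1) \<le> D * r powr (- \<sigma>)"
    and CD: "C + D \<le> B powr (1 / (p - 1))"
    and init: "f a \<le> B * a powr (- k)" and r: "r \<ge> a"
  shows "f r \<le> B * r powr (- k)"
proof -
  have "f r - B * r powr (- k) \<le> 0"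
  proof (rule nonpos_of_deriv_nonpos_where_pos[of a "\<lambda>r. f r - B * r powr (- k)"
        "\<lambda>r. f' r + k * B * r powr (- k - 1)"])
    fix s assume s: "s \<ge> a"
    then have s0: "s > 0" using a by simp
    show "((\<lambda>r. f r - B * r powr (- k)) has_real_derivative f' s + k * B * s powr (- k - 1)) (at s)"
      using s0 by (auto intro!: derivative_eq_intros der[OF s])
    assume "f s - B * s powr (- k) > 0"
    then have gt: "f s > B * s powr (- k)" by simp
    then have fs: "f s > 0" using B s0 by (smt (verit) mult_nonneg_nonneg powr_ge_zero)
    have "B powr (1 / (p - 1)) * s powr (- \<sigma>) \<le> s * f s powr (1 / (p - 1))"
      using gt k B p s0 by (intro damping_ge_of_ge_powr) auto
    \<comment> \<open>\<open>C\<close> pays for the forcing and \<open>D\<close> for the derivative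
      of the barrier.\<close>
    moreover have "(C + D) * s powr (- \<sigma>) \<le> B powr (1 / (p - 1)) * s powr (- \<sigma>)"
      using CD by (intro mult_right_mono) auto
    ultimately show "f' s + k * B * s powr (- k - 1) \<le> 0"
      using le[OF s fs] slow[OF s] by (simp add: algebra_simps)
  qed (use init r in auto)
  then show ?thesis by simp
qed

text \<open>For \<open>p > 2\<close> the damping exponent \<open>1 / (p - 1)\<close> is below 1, so
  \<open>f\<close> cannot stay above the barrier forever, whatever its size at \<open>a\<close>.
  Once below the barrier at some \<open>e\<close>, it remains there. The constant therefore does not
  depend on \<open>f\<close>.\<close>

lemma damped_eventually_le_powr:
  fixes f f' :: "real \<Rightarrow> real"
  assumes der: "\<And>r. r \<ge> a \<Longrightarrow> (f has_real_derivative f' r) (at r)"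
    and le: "\<And>r. r \<ge> a \<Longrightarrow> f r > 0 \<Longrightarrow>
               f' r \<le> - r * f r powr (1 / (p - 1)) + C * r powr (- \<sigma>)"
    and a: "a \<ge> 1" and p: "p > 2" and k: "k = (\<sigma> + 1) * (p - 1)" and s0: "\<sigma> > 0" and C: "C > 0"
  shows "\<forall>\<^sub>F r in at_top. f r \<le> (2 * C) powr (p - 1) * r powr (- k)"
proof -
  \<comment> \<open>The damping on the barrier is then \<open>2 * C * r powr (- \<sigma>)\<close>:
    one half for the forcing, one half for the derivative of the barrier.\<close>
  define B where "B = (2 * C) powr (p - 1)"
  have B: "B > 0" "B powr (1 / (p - 1)) = 2 * C"
    using C p by (auto simp: B_def powr_powr)
  have gain: "k + 1 - \<sigma> \<ge> 2"
  proof -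
    have "k + 1 - \<sigma> = 2 + (\<sigma> + 1) * (p - 2)" unfolding k by (simp add: algebra_simps)
    then show ?thesis using s0 p by simp
  qed
  have "((\<lambda>r. k * B * r powr (- (k + 1 - \<sigma>))) \<longlongrightarrow> 0) at_top"
    by (rule tendsto_mult_powr_neg) (use gain in simp)
  then have "\<forall>\<^sub>F r in at_top. k * B * r powr (- (k + 1 - \<sigma>)) < C"
    using C by (rule order_tendstoD)
  then obtain b where b: "\<And>r. r \<ge> b \<Longrightarrow> k * B * r powr (- (k + 1 - \<sigma>)) < C"
    by (auto simp: eventually_at_top_linorder)
  define m where "m = max a b"
  have slow: "k * B * r powr (- k - 1) \<le> C * r powr (- \<sigma>)" if "r \<ge> m" for r
  proof -
    have "k * B * r powr (- (k + 1 - \<sigma>)) * r powr (- \<sigma>) \<le> C * r powr (- \<sigma>)"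
      using b[of r] that by (intro mult_right_mono) (auto simp: m_def)
    moreover have "r powr (- (k + 1 - \<sigma>)) * r powr (- \<sigma>) = r powr (- k - 1)"
      by (simp flip: powr_add)
    ultimately show ?thesis by (simp add: mult.assoc)
  qed
  have "\<exists>r\<ge>m. f r \<le> B * r powr (- k)"
  proof (rule ccontr)
    assume "\<not> ?thesis"
    then have gt: "f r > B * r powr (- k)" if "r \<ge> m" for r using that by force
    have pos: "f r > 0" if "r \<ge> m" for r
      using gt[OF that] B by (smt (verit) mult_nonneg_nonneg powr_ge_zero)
    show False
    proof (rule no_positive_solution_of_sublinear_decay[of m f f' "1 / 2" "1 / (p - 1)"])
      fix r assume r: "r \<ge> m"
      then have r1: "r \<ge> 1" "r \<ge> a" using a by (auto simp: m_def)
      show "(f has_real_derivative f' r) (at r)" by (rule der) fact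
      show "f r > 0" by (rule pos) fact
      \<comment> \<open>Above the barrier half of the damping absorbs the forcing; the other half,
        with \<open>r \<ge> 1\<close>, gives the autonomous sublinear inequality.\<close>
      have "2 * C * r powr (- \<sigma>) \<le> r * f r powr (1 / (p - 1))"
        using damping_ge_of_ge_powr[of B r k "f r" \<sigma> p] gt[OF r] k B p r1 by simp
      moreover have "f r powr (1 / (p - 1)) \<le> r * f r powr (1 / (p - 1))"
        using r1 mult_right_mono[of 1 r "f r powr (1 / (p - 1))"] by simp
      ultimately show "f' r \<le> - (1 / 2) * f r powr (1 / (p - 1))"
        using le[OF r1(2) pos[OF r]] by simp
    qed (use p in auto)
  qed
  then obtain e where e: "e \<ge> m" "f e \<le> B * e powr (- k)" by blast
  have "f r \<le> B * r powr (- k)" if "r \<ge> e" for r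
    by (rule damped_le_powr[of e f f' p C \<sigma> k B C])
       (use e a p k B that slow der le in \<open>auto simp: m_def\<close>)
  then show ?thesis unfolding B_def[symmetric] by (auto simp: eventually_at_top_linorder)
qed

subsection \<open>Bounds on the flux\<close>

text \<open>The tail of a solution, with \<open>v\<close> for \<open>w'\<close> and \<phi> for the
  flux. The inequality \<open>(2 - p) * (\<alpha> + 1) < 2\<close> unites both cases: it is
  automatic for \<open>p > 2\<close> and means \<alpha> < \<delta> for \<open>p < 2\<close>.\<close>

locale decaying_solution =
  fixes n p q \<alpha> R :: real and w v \<phi> \<phi>' :: "real \<Rightarrow> real"
  assumes n: "n \<ge> 1" and p: "p > 1" and p2: "p \<noteq> 2" and q: "q > 1" and \<alpha>: "\<alpha> > 0" and R: "R \<ge> 1"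
    and subcritical: "(2 - p) * (\<alpha> + 1) < 2"
    and w_deriv: "\<And>r. r \<ge> R \<Longrightarrow> (w has_real_derivative v r) (at r)"
    and flux_deriv: "\<And>r. r \<ge> R \<Longrightarrow> (\<phi> has_real_derivative \<phi>' r) (at r)"
    and ode: "\<And>r. r \<ge> R \<Longrightarrow>
          \<phi>' r + (n - 1) / r * \<phi> r + r * v r + \<alpha> * w r + \<bar>w r\<bar> powr (q - 1) * w r = 0"
    and flux: "\<And>r. \<phi> r = \<bar>v r\<bar> powr (p - 2) * v r"
    and w_le_1: "\<And>r. r \<ge> R \<Longrightarrow> \<bar>w r\<bar> \<le> 1"
    and w_lim: "((\<lambda>r. r powr \<alpha> * w r) \<longlongrightarrow> 0) at_top"
begin

lemma abs_flux: "\<bar>\<phi> r\<bar> = \<bar>v r\<bar> powr (p - 1)"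
proof (cases "v r = 0")
  case False
  then have "\<bar>v r\<bar> powr (p - 2) * \<bar>v r\<bar> = \<bar>v r\<bar> powr (p - 1)"
    using powr_add[of "\<bar>v r\<bar>" "p - 2" 1] by simp
  then show ?thesis by (simp add: flux abs_mult)
qed (simp add: flux)

text \<open>Inverts the flux map, so that the term \<open>r w'\<close> becomes a damping term in
  \<phi>.\<close>

lemma v_eq: "v r = sgn (\<phi> r) * \<bar>\<phi> r\<bar> powr (1 / (p - 1))"
proof -
  have "\<bar>\<phi> r\<bar> powr (1 / (p - 1)) = \<bar>v r\<bar>"
    using p by (simp add: abs_flux powr_powr)
  moreover have "sgn (\<phi> r) = sgn (v r)"
    by (simp add: flux sgn_mult) (auto simp: sgn_if)
  ultimately show ?thesis by (simp add: sgn_mult_abs)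
qed

lemma abs_forcing_le:
  assumes "r \<ge> R" and "\<bar>w r\<bar> \<le> C * r powr (- \<sigma>)"
  shows "\<bar>\<alpha> * w r + \<bar>w r\<bar> powr (q - 1) * w r\<bar> \<le> (\<alpha> + 1) * C * r powr (- \<sigma>)"
proof -
  have "\<bar>w r\<bar> powr (q - 1) \<le> 1" using w_le_1[OF assms(1)] q by (intro powr_le1) auto
  then have "(\<alpha> + \<bar>w r\<bar> powr (q - 1)) * \<bar>w r\<bar> \<le> (\<alpha> + 1) * (C * r powr (- \<sigma>))"
    using assms \<alpha> by (intro mult_mono) auto
  moreover have "\<bar>\<alpha> * w r + \<bar>w r\<bar> powr (q - 1) * w r\<bar> = (\<alpha> + \<bar>w r\<bar> powr (q - 1)) * \<bar>w r\<bar>"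
    using \<alpha> by (simp add: abs_mult flip: distrib_right)
  ultimately show ?thesis by (simp add: mult.assoc)
qed

text \<open>The equation is multiplied by a sign \<open>e\<close>, so that one statement bounds
  \<phi> from above and from below. Where \<open>e * \<phi> r > 0\<close> the term with
  \<open>n - 1\<close> has the favourable sign and is dropped.\<close>

lemma signed_flux_deriv_le:
  assumes r: "r \<ge> R" and w: "\<bar>w r\<bar> \<le> C * r powr (- \<sigma>)" and e: "\<bar>e\<bar> = 1" and pos: "e * \<phi> r > 0"
  shows "e * \<phi>' r \<le> - r * (e * \<phi> r) powr (1 / (p - 1)) + (\<alpha> + 1) * C * r powr (- \<sigma>)"
proof -
  have sgn_e: "e = sgn (\<phi> r)" using e pos by (auto simp: abs_if sgn_if split: if_splits)
  then have "e * v r = (e * \<phi> r) powr (1 / (p - 1))"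
    using v_eq[of r] pos by (simp add: sgn_if abs_if split: if_splits)
  moreover have "(n - 1) / r * (e * \<phi> r) \<ge> 0"
    by (rule mult_nonneg_nonneg) (use n R r pos in auto)
  moreover have "e * \<phi>' r = - ((n - 1) / r * (e * \<phi> r)) - r * (e * v r)
      - e * (\<alpha> * w r + \<bar>w r\<bar> powr (q - 1) * w r)"
    using arg_cong[OF ode[OF r], of "\<lambda>x. e * x"] by (simp add: algebra_simps)
  moreover have "\<bar>e * (\<alpha> * w r + \<bar>w r\<bar> powr (q - 1) * w r)\<bar> \<le> (\<alpha> + 1) * C * r powr (- \<sigma>)"
    using abs_forcing_le[OF r w] e by (simp add: abs_mult)
  ultimately show ?thesis by simp
qed

lemma flux_decay_superquadratic:
  assumes "p > 2" and a: "a \<ge> R" and C: "C > 0" and \<sigma>: "\<sigma> > 0"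
    and w: "\<And>r. r \<ge> a \<Longrightarrow> \<bar>w r\<bar> \<le> C * r powr (- \<sigma>)"
  shows "\<forall>\<^sub>F r in at_top. \<bar>\<phi> r\<bar> \<le> (2 * ((\<alpha> + 1) * C)) powr (p - 1) * r powr (- ((\<sigma> + 1) * (p - 1)))"
proof -
  have *: "\<forall>\<^sub>F r in at_top. e * \<phi> r \<le> (2 * ((\<alpha> + 1) * C)) powr (p - 1) * r powr (- ((\<sigma> + 1) * (p - 1)))"
    if e: "\<bar>e\<bar> = 1" for e
  proof (rule damped_eventually_le_powr[of a "\<lambda>r. e * \<phi> r" "\<lambda>r. e * \<phi>' r" p "(\<alpha> + 1) * C" \<sigma>])
    fix r assume r: "r \<ge> a"
    show "((\<lambda>r. e * \<phi> r) has_real_derivative e * \<phi>' r) (at r)"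
      using r a by (intro DERIV_cmult flux_deriv) simp
    show "e * \<phi>' r \<le> - r * (e * \<phi> r) powr (1 / (p - 1)) + (\<alpha> + 1) * C * r powr (- \<sigma>)"
      if "e * \<phi> r > 0"
      using r a that e by (intro signed_flux_deriv_le w) auto
  qed (use assms R \<alpha> in auto)
  have "\<bar>1 :: real\<bar> = 1" "\<bar>- 1 :: real\<bar> = 1" by simp_all
  from this[THEN *] show ?thesis by eventually_elim auto
qed

text \<open>For \<open>p < 2\<close> the damping is superlinear and gives no finite-time entry, so
  the barrier is made large enough to lie above the flux already at \<open>a\<close>. The constant
  \<open>L\<close> is chosen before \<sigma> and \<open>C\<close>; this uniformity is what later
  permits \<sigma> to tend to \<delta>.\<close>

lemma flux_decay_subquadratic:
  assumes "p < 2" and a: "a \<ge> R"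
  shows "\<exists>L>0. \<forall>\<sigma> C. \<sigma> > 0 \<longrightarrow> (2 - p) * (\<sigma> + 1) \<le> 2 \<longrightarrow> C \<ge> 1 \<longrightarrow>
           (\<forall>r\<ge>a. \<bar>w r\<bar> \<le> C * r powr (- \<sigma>)) \<longrightarrow>
           (\<forall>r\<ge>a. \<bar>\<phi> r\<bar> \<le> L * C powr (p - 1) * r powr (- ((\<sigma> + 1) * (p - 1))))"
proof -
  \<comment> \<open>The largest value of \<open>(\<sigma> + 1) * (p - 1)\<close> allowed by
    \<open>(2 - p) * (\<sigma> + 1) \<le> 2\<close>.\<close>
  define K where "K = 2 / (2 - p) * (p - 1)"
  define m where "m = 1 / (p - 1)"
  \<comment> \<open>The second entry handles the initial value at \<open>a\<close>. The third gives
    \<open>L powr (m - 1) \<ge> \<alpha> + 1 + K\<close>, so the damping coefficient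
    \<open>L powr m\<close> beats forcing and barrier derivative together.\<close>
  define L where "L = max 1 (max (\<bar>\<phi> a\<bar> * a powr K) ((\<alpha> + 1 + K) powr (1 / (m - 1))))"
  have K: "K > 0" and m: "m > 1" using p assms by (auto simp: K_def m_def)
  have a1: "a \<ge> 1" using a R by simp
  have L: "L \<ge> 1" "\<bar>\<phi> a\<bar> * a powr K \<le> L" "(\<alpha> + 1 + K) powr (1 / (m - 1)) \<le> L"
    by (auto simp: L_def)
  have "((\<alpha> + 1 + K) powr (1 / (m - 1))) powr (m - 1) \<le> L powr (m - 1)"
    using L m by (intro powr_mono2) auto
  then have "\<alpha> + 1 + K \<le> L powr (m - 1)" using K \<alpha> m by (simp add: powr_powr)
  then have "L * (\<alpha> + 1 + K) \<le> L * L powr (m - 1)" using L by (intro mult_left_mono) auto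
  also have "L * L powr (m - 1) = L powr m" using L powr_add[of L 1 "m - 1"] by simp
  finally have "(\<alpha> + 1) * L + K * L \<le> L powr m" by (simp add: algebra_simps)
  moreover have "\<alpha> + 1 \<le> (\<alpha> + 1) * L" using L \<alpha> by simp
  ultimately have L_large: "\<alpha> + 1 + K * L \<le> L powr m" by linarith
  have *: "\<bar>\<phi> r\<bar> \<le> L * C powr (p - 1) * r powr (- k)"
    if k: "k = (\<sigma> + 1) * (p - 1)" and \<sigma>: "\<sigma> > 0" "(2 - p) * (\<sigma> + 1) \<le> 2" and C: "C \<ge> 1"
      and w: "\<And>r. r \<ge> a \<Longrightarrow> \<bar>w r\<bar> \<le> C * r powr (- \<sigma>)" and r: "r \<ge> a" for \<sigma> C r k
  proof -
    define B where "B = L * C powr (p - 1)"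
    have kK: "k \<le> K" unfolding k K_def using \<sigma> p assms
      by (intro mult_right_mono) (auto simp: field_simps)
    have k0: "k > 0" unfolding k using \<sigma> p by simp
    have k\<sigma>: "- k - 1 \<le> - \<sigma>" using \<sigma> unfolding k by (simp add: algebra_simps)
    have Cp: "C powr (p - 1) \<ge> 1" "C powr (p - 1) \<le> C"
      using C p assms ge_one_powr_ge_zero[of C "p - 1"] powr_mono[of "p - 1" 1 C] by auto
    have B: "B > 0" "B \<ge> L" using L Cp mult_left_mono[of 1 "C powr (p - 1)" L] by (auto simp: B_def)
    have slow: "k * B * r powr (- k - 1) \<le> k * B * r powr (- \<sigma>)" if "r \<ge> a" for r
      using that k0 B a1 k\<sigma> by (intro mult_left_mono powr_mono) auto
    \<comment> \<open>As \<open>(p - 1) * m = 1\<close>, the damping scales linearly in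
      \<open>C\<close>, just like the forcing, while \<open>C powr (p - 1) \<le> C\<close> controls
      the barrier derivative. Hence \<open>L\<close> works for every
      \<open>C \<ge> 1\<close>.\<close>
    have "B powr m = L powr m * C"
      using L C p by (simp add: B_def powr_mult powr_powr m_def)
    moreover have "(\<alpha> + 1 + K * L) * C \<le> L powr m * C"
      using L_large C by (intro mult_right_mono) auto
    moreover have "k * B \<le> K * L * C"
      unfolding B_def mult.assoc using kK k0 L Cp C by (intro mult_mono) auto
    ultimately have CD: "(\<alpha> + 1) * C + k * B \<le> B powr (1 / (p - 1))"
      by (simp add: m_def algebra_simps)
    have "\<bar>\<phi> a\<bar> \<le> L * a powr (- K)"
      using L(2) a1 by (simp add: powr_minus field_simps)
    also have "\<dots> \<le> B * a powr (- k)" using B kK a1 L by (intro mult_mono powr_mono) auto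
    finally have init: "\<bar>\<phi> a\<bar> \<le> B * a powr (- k)" .
    have "e * \<phi> r \<le> B * r powr (- k)" if e: "\<bar>e\<bar> = 1" for e
    proof (rule damped_le_powr[of a "\<lambda>r. e * \<phi> r" "\<lambda>r. e * \<phi>' r" p "(\<alpha> + 1) * C" \<sigma> k B "k * B"])
      fix r assume r: "r \<ge> a"
      show "((\<lambda>r. e * \<phi> r) has_real_derivative e * \<phi>' r) (at r)"
        using r a by (intro DERIV_cmult flux_deriv) simp
      show "e * \<phi>' r \<le> - r * (e * \<phi> r) powr (1 / (p - 1)) + (\<alpha> + 1) * C * r powr (- \<sigma>)"
        if "e * \<phi> r > 0"
        using r a that e by (intro signed_flux_deriv_le w) auto
    next
      have "e * \<phi> a \<le> \<bar>\<phi> a\<bar>" using e by (metis abs_ge_self abs_mult mult_1)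
      then show "e * \<phi> a \<le> B * a powr (- k)" using init by simp
    qed (use a1 p k B slow CD \<open>r \<ge> a\<close> in auto)
    from this[of 1] this[of "- 1"] show ?thesis unfolding B_def by simp
  qed
  show ?thesis
    using L(1) * by (intro exI[of _ L]) auto
qed

subsection \<open>Self-improving decay\<close>

definition decays :: "real \<Rightarrow> bool" where
  "decays \<sigma> \<longleftrightarrow> (\<exists>C. \<forall>\<^sub>F r in at_top. \<bar>w r\<bar> \<le> C * r powr (- \<sigma>))"

lemma decays_E:
  assumes "decays \<sigma>"
  obtains C a where "C \<ge> 1" "a \<ge> R" "\<And>r. r \<ge> a \<Longrightarrow> \<bar>w r\<bar> \<le> C * r powr (- \<sigma>)"
proof -
  from assms obtain C a where *: "\<And>r. r \<ge> a \<Longrightarrow> \<bar>w r\<bar> \<le> C * r powr (- \<sigma>)"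
    by (auto simp: decays_def eventually_at_top_linorder)
  have "\<bar>w r\<bar> \<le> max 1 C * r powr (- \<sigma>)" if "r \<ge> max a R" for r
    using *[of r] that mult_right_mono[of C "max 1 C" "r powr (- \<sigma>)"] by simp
  then show ?thesis by (intro that[of "max 1 C" "max a R"]) auto
qed

lemma flux_decay:
  assumes "decays \<sigma>" and \<sigma>: "\<sigma> > 0" "(2 - p) * (\<sigma> + 1) < 2"
  shows "\<exists>B. \<forall>\<^sub>F r in at_top. \<bar>\<phi> r\<bar> \<le> B * r powr (- ((\<sigma> + 1) * (p - 1)))"
proof -
  obtain C a where C: "C \<ge> 1" "a \<ge> R" "\<And>r. r \<ge> a \<Longrightarrow> \<bar>w r\<bar> \<le> C * r powr (- \<sigma>)"
    using assms(1) by (elim decays_E) blast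
  show ?thesis
  proof (cases "p > 2")
    case True
    show ?thesis using flux_decay_superquadratic[OF True C(2) _ \<sigma>(1) C(3)] C(1) by auto
  next
    case False
    then have "p < 2" using p2 by simp
    from flux_decay_subquadratic[OF this C(2)] obtain L where
      "\<forall>r\<ge>a. \<bar>\<phi> r\<bar> \<le> L * C powr (p - 1) * r powr (- ((\<sigma> + 1) * (p - 1)))"
      using C \<sigma> by (meson less_imp_le)
    then show ?thesis by (auto simp: eventually_at_top_linorder)
  qed
qed

lemma decays_alpha: "decays \<alpha>"
proof -
  have "\<forall>\<^sub>F r in at_top. \<bar>r powr \<alpha> * w r\<bar> < 1"
    using order_tendstoD(2)[OF tendsto_rabs[OF w_lim], of 1] by simp
  then have "\<forall>\<^sub>F r in at_top. \<bar>w r\<bar> \<le> 1 * r powr (- \<alpha>)"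
    using eventually_gt_at_top[of 0]
    by eventually_elim (simp add: powr_minus field_simps abs_mult)
  then show ?thesis unfolding decays_def by blast
qed

text \<open>
  In \<open>J'\<close> the leading terms \<open>r w'\<close> and \<open>\<alpha> w\<close> of the equation cancel. Since \<open>J \<rightarrow> 0\<close>, integrating
  \<open>J'\<close> from infinity expresses \<open>w\<close> through lower-order terms.
\<close>
definition J :: "real \<Rightarrow> real" where
  "J r = r powr \<alpha> * w r + r powr (\<alpha> - 1) * \<phi> r"

lemma J_deriv:
  assumes "r \<ge> R"
  shows "(J has_real_derivative
           (\<alpha> - n) * r powr (\<alpha> - 2) * \<phi> r - r powr (\<alpha> - 1) * (\<bar>w r\<bar> powr (q - 1) * w r)) (at r)"
proof -
  have r: "r > 0" using assms R by simp
  have 1: "r powr \<alpha> = r * r * r powr (\<alpha> - 2)" "r powr (\<alpha> - 1) = r * r powr (\<alpha> - 2)"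
    using r powr_add[of r 2 "\<alpha> - 2"] powr_add[of r 1 "\<alpha> - 2"] by (auto simp: power2_eq_square)
  have 2: "\<phi>' r = - ((n - 1) / r * \<phi> r) - r * v r - \<alpha> * w r - \<bar>w r\<bar> powr (q - 1) * w r"
    using ode[OF assms] by simp
  show ?thesis unfolding J_def
    by (rule derivative_eq_intros w_deriv[OF assms] flux_deriv[OF assms] refl r)+
       (use r in \<open>simp add: 1 2 field_simps\<close>)
qed

lemma abs_w_le_J:
  assumes "r \<ge> R"
  shows "\<bar>w r\<bar> \<le> r powr (- \<alpha>) * \<bar>J r\<bar> + \<bar>\<phi> r\<bar> / r"
proof -
  have r: "r > 0" using assms R by simp
  have "w r = r powr (- \<alpha>) * J r - \<phi> r / r"
    using r by (simp add: J_def powr_minus powr_diff field_simps)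
  then have "\<bar>w r\<bar> \<le> \<bar>r powr (- \<alpha>) * J r\<bar> + \<bar>\<phi> r / r\<bar>"
    by (metis abs_triangle_ineq4)
  then show ?thesis using r by (simp add: abs_mult)
qed

text \<open>The first summand is the decay hypothesis. For the second, the rate \<alpha> of
  \<open>w\<close> gives the rate \<open>k\<close> of the flux, and the subcriticality assumption
  says precisely \<open>k + 1 > \<alpha>\<close>.\<close>

lemma J_tendsto_0: "(J \<longlongrightarrow> 0) at_top"
proof -
  define k where "k = (\<alpha> + 1) * (p - 1)"
  obtain B where B: "\<forall>\<^sub>F r in at_top. \<bar>\<phi> r\<bar> \<le> B * r powr (- k)"
    using flux_decay[OF decays_alpha \<alpha> subcritical] unfolding k_def by blast
  have k: "k + 1 - \<alpha> > 0" using subcritical by (simp add: k_def algebra_simps)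
  have "((\<lambda>r. r powr (\<alpha> - 1) * \<phi> r) \<longlongrightarrow> 0) at_top"
  proof (rule Lim_null_comparison)
    show "((\<lambda>r. B * r powr (- (k + 1 - \<alpha>))) \<longlongrightarrow> 0) at_top" by (rule tendsto_mult_powr_neg[OF k])
    show "\<forall>\<^sub>F r in at_top. norm (r powr (\<alpha> - 1) * \<phi> r) \<le> B * r powr (- (k + 1 - \<alpha>))"
      using B
    proof eventually_elim
      case (elim r)
      then have "r powr (\<alpha> - 1) * \<bar>\<phi> r\<bar> \<le> r powr (\<alpha> - 1) * (B * r powr (- k))"
        by (intro mult_left_mono) auto
      also have "\<dots> = B * (r powr (\<alpha> - 1) * r powr (- k))" by simp
      also have "r powr (\<alpha> - 1) * r powr (- k) = r powr (- (k + 1 - \<alpha>))"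
        unfolding powr_add[symmetric] by (rule arg_cong[where f = "\<lambda>x. r powr x"]) simp
      finally show ?case by (simp add: abs_mult)
    qed
  qed
  from tendsto_add[OF w_lim this] show ?thesis by (simp add: J_def[abs_def])
qed

lemma abs_J_deriv_le:
  "\<bar>(\<alpha> - n) * r powr (\<alpha> - 2) * \<phi> r - r powr (\<alpha> - 1) * (\<bar>w r\<bar> powr (q - 1) * w r)\<bar>
     \<le> \<bar>\<alpha> - n\<bar> * (r powr (\<alpha> - 2) * \<bar>\<phi> r\<bar>) + r powr (\<alpha> - 1) * \<bar>w r\<bar> powr q"
proof -
  have "\<bar>w r\<bar> powr (q - 1) * \<bar>w r\<bar> = \<bar>w r\<bar> powr q"
    using powr_add[of "\<bar>w r\<bar>" "q - 1" 1] by (cases "w r = 0") auto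
  then show ?thesis
    by (intro order_trans[OF abs_triangle_ineq4]) (simp add: abs_mult mult.assoc)
qed

text \<open>The conditions \<open>k + 1 > \<alpha>\<close> and \<open>\<tau> > \<alpha>\<close> make
  the bounds on \<open>J'\<close> integrable at infinity; the summand 1 in the first constant comes
  from \<open>\<phi> r / r\<close>. The constants are explicit because the critical rate needs them
  uniformly in \<sigma>.\<close>

lemma w_le_of_flux_le:
  assumes a: "a \<ge> R" and flux_le: "\<And>r. r \<ge> a \<Longrightarrow> \<bar>\<phi> r\<bar> \<le> B * r powr (- k)"
    and w: "\<And>r. r \<ge> a \<Longrightarrow> \<bar>w r\<bar> powr q \<le> C * r powr (- \<tau>)"
    and k: "k + 1 > \<alpha>" and \<tau>: "\<tau> > \<alpha>" and r: "r \<ge> a"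
  shows "\<bar>w r\<bar> \<le> B * (1 + \<bar>\<alpha> - n\<bar> / (k + 1 - \<alpha>)) * r powr (- (k + 1)) + C / (\<tau> - \<alpha>) * r powr (- \<tau>)"
proof -
  \<comment> \<open>The integral of \<open>h'\<close> from \<open>s\<close> to infinity, where
    \<open>h'\<close> is the bound on \<open>\<bar>J'\<bar>\<close>.\<close>
  define h where "h = (\<lambda>s. \<bar>\<alpha> - n\<bar> * B / (k + 1 - \<alpha>) * s powr (- (k + 1 - \<alpha>)) + C / (\<tau> - \<alpha>) * s powr (- (\<tau> - \<alpha>)))"
  define h' where "h' = (\<lambda>s. \<bar>\<alpha> - n\<bar> * B * s powr (\<alpha> - k - 2) + C * s powr (\<alpha> - \<tau> - 1))"
  have r0: "r > 0" using r a R by simp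
  have "\<bar>J r\<bar> \<le> h r"
  proof (rule abs_le_of_abs_deriv_le[of r J _ h h'])
    fix s assume s: "s \<ge> r"
    then have s0: "s > 0" and sa: "s \<ge> a" using r0 r by auto
    show "(J has_real_derivative
        (\<alpha> - n) * s powr (\<alpha> - 2) * \<phi> s - s powr (\<alpha> - 1) * (\<bar>w s\<bar> powr (q - 1) * w s)) (at s)"
      by (rule J_deriv) (use s r a in auto)
    show "(h has_real_derivative - h' s) (at s)"
      unfolding h_def
      using DERIV_add[OF has_real_derivative_mult_powr_neg[OF _ s0, of "k + 1 - \<alpha>" "\<bar>\<alpha> - n\<bar> * B"]
          has_real_derivative_mult_powr_neg[OF _ s0, of "\<tau> - \<alpha>" C]] k \<tau>
      by (simp add: h'_def algebra_simps)
    have "s powr (\<alpha> - 2) * \<bar>\<phi> s\<bar> \<le> s powr (\<alpha> - 2) * (B * s powr (- k))"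
      using flux_le[OF sa] by (intro mult_left_mono) auto
    also have "\<dots> = B * s powr (\<alpha> - k - 2)" by (simp add: powr_add[symmetric] algebra_simps)
    finally have 1: "\<bar>\<alpha> - n\<bar> * (s powr (\<alpha> - 2) * \<bar>\<phi> s\<bar>) \<le> \<bar>\<alpha> - n\<bar> * (B * s powr (\<alpha> - k - 2))"
      by (intro mult_left_mono) auto
    have "s powr (\<alpha> - 1) * \<bar>w s\<bar> powr q \<le> s powr (\<alpha> - 1) * (C * s powr (- \<tau>))"
      using w[OF sa] by (intro mult_left_mono) auto
    also have "\<dots> = C * s powr (\<alpha> - \<tau> - 1)" by (simp add: powr_add[symmetric] algebra_simps)
    finally have 2: "s powr (\<alpha> - 1) * \<bar>w s\<bar> powr q \<le> C * s powr (\<alpha> - \<tau> - 1)" .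
    show "\<bar>(\<alpha> - n) * s powr (\<alpha> - 2) * \<phi> s - s powr (\<alpha> - 1) * (\<bar>w s\<bar> powr (q - 1) * w s)\<bar> \<le> h' s"
      using abs_J_deriv_le[of s] 1 2 unfolding h'_def mult.assoc by linarith
  next
    show "(h \<longlongrightarrow> 0) at_top" unfolding h_def
      using tendsto_add[OF tendsto_mult_powr_neg tendsto_mult_powr_neg,
          of "k + 1 - \<alpha>" "\<tau> - \<alpha>" "\<bar>\<alpha> - n\<bar> * B / (k + 1 - \<alpha>)" "C / (\<tau> - \<alpha>)"] k \<tau> by simp
  qed (rule J_tendsto_0)
  then have "r powr (- \<alpha>) * \<bar>J r\<bar> \<le> r powr (- \<alpha>) * h r" by (intro mult_left_mono) auto
  also have "\<dots> = \<bar>\<alpha> - n\<bar> * B / (k + 1 - \<alpha>) * (r powr (- \<alpha>) * r powr (- (k + 1 - \<alpha>)))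
      + C / (\<tau> - \<alpha>) * (r powr (- \<alpha>) * r powr (- (\<tau> - \<alpha>)))"
    by (simp add: h_def distrib_left mult.left_commute)
  also have "r powr (- \<alpha>) * r powr (- (k + 1 - \<alpha>)) = r powr (- (k + 1))"
    by (simp add: powr_add[symmetric])
  also have "r powr (- \<alpha>) * r powr (- (\<tau> - \<alpha>)) = r powr (- \<tau>)"
    by (simp add: powr_add[symmetric])
  finally have 1: "r powr (- \<alpha>) * \<bar>J r\<bar>
      \<le> \<bar>\<alpha> - n\<bar> * B / (k + 1 - \<alpha>) * r powr (- (k + 1)) + C / (\<tau> - \<alpha>) * r powr (- \<tau>)" .
  have "\<bar>\<phi> r\<bar> / r \<le> B * r powr (- k) / r" using flux_le[OF r] r0 by (intro divide_right_mono) auto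
  also have "\<dots> = B * r powr (- (k + 1))"
  proof -
    have "- (k + 1) = - k - 1" by simp
    then show ?thesis using r0 powr_diff[of r "- k" 1] by simp
  qed
  finally show ?thesis using abs_w_le_J[of r] 1 r a by (simp add: algebra_simps)
qed

lemma decays_mono:
  assumes "decays \<sigma>" and "\<tau> \<le> \<sigma>"
  shows "decays \<tau>"
proof -
  from assms(1) obtain C a where C: "C \<ge> 1" "a \<ge> R" "\<And>r. r \<ge> a \<Longrightarrow> \<bar>w r\<bar> \<le> C * r powr (- \<sigma>)"
    by (elim decays_E) blast
  have "\<bar>w r\<bar> \<le> C * r powr (- \<tau>)" if "r \<ge> a" for r
  proof -
    have "C * r powr (- \<sigma>) \<le> C * r powr (- \<tau>)"
      using that C R assms(2) by (intro mult_left_mono powr_mono) auto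
    then show ?thesis using C(3)[OF that] by simp
  qed
  then show ?thesis unfolding decays_def by (auto simp: eventually_at_top_linorder)
qed

text \<open>The two new rates come from the two sources left in \<open>J\<close>: the flux yields
  \<open>k + 1\<close>, the nonlinearity yields \<open>q * \<sigma>\<close>. Subcriticality of
  \<sigma> gives \<open>k + 1 > \<sigma> \<ge> \<alpha>\<close>.\<close>

lemma decays_improve:
  assumes dec: "decays \<sigma>" and \<sigma>: "\<sigma> \<ge> \<alpha>" "(2 - p) * (\<sigma> + 1) < 2"
  shows "decays (min ((\<sigma> + 1) * (p - 1) + 1) (q * \<sigma>))"
proof -
  define k where "k = (\<sigma> + 1) * (p - 1)"
  define \<tau> where "\<tau> = min (k + 1) (q * \<sigma>)"
  obtain C a where C: "C \<ge> 1" "a \<ge> R" "\<And>r. r \<ge> a \<Longrightarrow> \<bar>w r\<bar> \<le> C * r powr (- \<sigma>)"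
    using dec by (elim decays_E) blast
  obtain B b where B: "\<And>r. r \<ge> b \<Longrightarrow> \<bar>\<phi> r\<bar> \<le> B * r powr (- k)"
    using flux_decay[OF dec] \<sigma> \<alpha> unfolding k_def by (auto simp: eventually_at_top_linorder)
  have k: "k + 1 > \<alpha>" using \<sigma> by (simp add: k_def algebra_simps)
  have q\<sigma>: "q * \<sigma> > \<alpha>" using \<sigma>(1) \<alpha> q mult_strict_right_mono[of 1 q \<sigma>] by linarith
  have wq: "\<bar>w r\<bar> powr q \<le> C powr q * r powr (- (q * \<sigma>))" if "r \<ge> a" for r
  proof -
    have "\<bar>w r\<bar> powr q \<le> (C * r powr (- \<sigma>)) powr q" using C(3)[OF that] q by (intro powr_mono2) auto
    also have "\<dots> = C powr q * r powr (- (q * \<sigma>))"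
      using C by (simp add: powr_mult powr_powr mult.commute)
    finally show ?thesis .
  qed
  \<comment> \<open>\<open>B\<close> may be negative, whereas the monotonicity estimate below needs
    a nonnegative constant.\<close>
  define c where "c = max 0 (B * (1 + \<bar>\<alpha> - n\<bar> / (k + 1 - \<alpha>)))"
  define d where "d = C powr q / (q * \<sigma> - \<alpha>)"
  have "\<bar>w r\<bar> \<le> (c + d) * r powr (- \<tau>)" if r: "r \<ge> max a b" for r
  proof -
    have r1: "r \<ge> 1" using r C R by simp
    have "\<bar>w r\<bar> \<le> B * (1 + \<bar>\<alpha> - n\<bar> / (k + 1 - \<alpha>)) * r powr (- (k + 1)) + d * r powr (- (q * \<sigma>))"
      unfolding d_def using r C(2) B wq k q\<sigma> by (intro w_le_of_flux_le[of "max a b"]) auto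
    also have "B * (1 + \<bar>\<alpha> - n\<bar> / (k + 1 - \<alpha>)) * r powr (- (k + 1)) \<le> c * r powr (- \<tau>)"
      using r1 by (intro mult_mono powr_mono) (auto simp: c_def \<tau>_def)
    also have "d * r powr (- (q * \<sigma>)) \<le> d * r powr (- \<tau>)"
      using r1 q\<sigma> by (intro mult_left_mono powr_mono) (auto simp: d_def \<tau>_def)
    finally show ?thesis by (simp add: algebra_simps)
  qed
  then have "decays \<tau>" unfolding decays_def eventually_at_top_linorder by blast
  then show ?thesis by (simp add: \<tau>_def k_def)
qed

text \<open>Starting from \<alpha>, each improvement raises the rate by at least a fixed \<eta> > 0.
  Truncating at \<open>T\<close> keeps every intermediate rate subcritical, and finitely many rounds
  reach \<open>T\<close>.\<close>

lemma decays_subcritical: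
  assumes T: "(2 - p) * (T + 1) < 2"
  shows "decays T"
proof (cases "T \<le> \<alpha>")
  case True
  then show ?thesis using decays_mono decays_alpha by blast
next
  case False
  \<comment> \<open>The flux rate grows by \<open>2 - (2 - p) * (\<sigma> + 1)\<close>, which for
    \<alpha> \<le> \<sigma> \<le> \<open>T\<close> is at least its value at \<open>T\<close> if
    \<open>p < 2\<close> and at least 2 if \<open>p > 2\<close>; the other rate grows by
    \<open>(q - 1) * \<sigma> \<ge> (q - 1) * \<alpha>\<close>.\<close>
  define \<eta> where "\<eta> = min (min 2 (2 - (2 - p) * (T + 1))) ((q - 1) * \<alpha>)"
  have \<eta>: "\<eta> > 0" using T q \<alpha> by (auto simp: \<eta>_def)
  have *: "decays (min T (\<alpha> + real m * \<eta>))" for m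
  proof (induction m)
    case 0
    then show ?case using False decays_alpha by simp
  next
    case (Suc m)
    define \<sigma> where "\<sigma> = min T (\<alpha> + real m * \<eta>)"
    have \<sigma>: "\<sigma> \<ge> \<alpha>" "\<sigma> \<le> T" using False \<eta> by (auto simp: \<sigma>_def)
    have gain: "2 - (2 - p) * (\<sigma> + 1) \<ge> min 2 (2 - (2 - p) * (T + 1))"
    proof (cases "p < 2")
      case True
      then have "(2 - p) * (\<sigma> + 1) \<le> (2 - p) * (T + 1)" using \<sigma> by (intro mult_left_mono) auto
      then show ?thesis by simp
    next
      case False
      then have "(2 - p) * (\<sigma> + 1) \<le> 0" using \<sigma> \<alpha> by (intro mult_nonpos_nonneg) auto
      then show ?thesis by simp
    qed
    have "decays (min ((\<sigma> + 1) * (p - 1) + 1) (q * \<sigma>))"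
      using gain T Suc \<sigma> by (intro decays_improve) (auto simp: \<sigma>_def[symmetric])
    moreover have "(\<sigma> + 1) * (p - 1) + 1 \<ge> \<sigma> + \<eta>"
    proof -
      have "(\<sigma> + 1) * (p - 1) + 1 = \<sigma> + (2 - (2 - p) * (\<sigma> + 1))" by (simp add: algebra_simps)
      then show ?thesis using gain by (simp add: \<eta>_def)
    qed
    moreover have "q * \<sigma> \<ge> \<sigma> + \<eta>"
    proof -
      have "(q - 1) * \<alpha> \<le> (q - 1) * \<sigma>" using \<sigma> q by (intro mult_left_mono) auto
      moreover have "\<eta> \<le> (q - 1) * \<alpha>" by (simp add: \<eta>_def)
      moreover have "q * \<sigma> = \<sigma> + (q - 1) * \<sigma>" by (simp add: algebra_simps)
      ultimately show ?thesis by linarith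
    qed
    moreover have "min T (\<alpha> + real (Suc m) * \<eta>) \<le> \<sigma> + \<eta>"
      using \<eta> by (auto simp: \<sigma>_def algebra_simps)
    ultimately show ?case by (elim decays_mono) auto
  qed
  obtain m :: nat where "T < real m * \<eta>" using reals_Archimedean3[OF \<eta>] by blast
  then show ?thesis using *[of m] \<alpha> by (simp add: min_absorb1)
qed


subsection \<open>The critical rate for \<open>p < 2\<close>\<close>

text \<open>
  For \<open>\<sigma> < \<delta>\<close> the best constant \<open>C\<close> in \<open>\<bar>w r\<bar> \<le> C r powr (- \<sigma>)\<close> is finite and satisfies
  \<open>C \<le> K1 C powr (p - 1) + K0\<close> with \<open>K0, K1\<close> independent of \<open>\<sigma>\<close>; as \<open>p - 1 < 1\<close>, it stays
  bounded when \<open>\<sigma> \<rightarrow> \<delta>\<close>.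
\<close>
lemma delta_decay_subquadratic:
  assumes "p < 2"
  shows "\<exists>C. \<forall>\<^sub>F r in at_top. \<bar>w r\<bar> \<le> C * r powr (- (p / (2 - p)))"
proof -
  define \<delta> where "\<delta> = p / (2 - p)"
  have \<delta>: "\<delta> > \<alpha>" using assms subcritical by (simp add: \<delta>_def field_simps)
  have sub: "(2 - p) * (\<sigma> + 1) < 2" if "\<sigma> < \<delta>" for \<sigma>
    using that assms by (simp add: \<delta>_def field_simps)
  have "\<delta> / q < \<delta>" using \<delta> \<alpha> q by (simp add: field_simps)
  \<comment> \<open>Above \<open>\<delta> / q\<close>, so that \<open>\<bar>w\<bar> powr q\<close>
    already decays at the rate \<delta>; above \<alpha>, so that the denominators
    \<open>k + 1 - \<alpha>\<close> stay at least \<open>\<sigma>0 - \<alpha>\<close>.\<close>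
  then obtain \<sigma>0 where \<sigma>0: "max \<alpha> (\<delta> / q) < \<sigma>0" "\<sigma>0 < \<delta>" using \<delta> dense[of "max \<alpha> (\<delta> / q)" \<delta>] by auto
  obtain C0 a where C0: "C0 \<ge> 1" "a \<ge> R" "\<And>r. r \<ge> a \<Longrightarrow> \<bar>w r\<bar> \<le> C0 * r powr (- \<sigma>0)"
    using decays_subcritical[OF sub[OF \<sigma>0(2)]] by (elim decays_E) blast
  have a1: "a \<ge> 1" using C0 R by simp
  have wq: "\<bar>w r\<bar> powr q \<le> C0 powr q * r powr (- \<delta>)" if "r \<ge> a" for r
  proof -
    have "\<bar>w r\<bar> powr q \<le> (C0 * r powr (- \<sigma>0)) powr q" using C0(3)[OF that] q by (intro powr_mono2) auto
    also have "\<dots> = C0 powr q * r powr (- (\<sigma>0 * q))"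
      using C0 by (simp add: powr_mult powr_powr)
    also have "\<dots> \<le> C0 powr q * r powr (- \<delta>)"
      using that a1 \<sigma>0 q by (intro mult_left_mono powr_mono) (auto simp: field_simps)
    finally show ?thesis .
  qed
  obtain L where L: "L > 0" and flux_le: "\<And>\<sigma> C r. \<sigma> > 0 \<Longrightarrow> (2 - p) * (\<sigma> + 1) \<le> 2 \<Longrightarrow> C \<ge> 1 \<Longrightarrow>
           (\<And>r. r \<ge> a \<Longrightarrow> \<bar>w r\<bar> \<le> C * r powr (- \<sigma>)) \<Longrightarrow> r \<ge> a \<Longrightarrow>
           \<bar>\<phi> r\<bar> \<le> L * C powr (p - 1) * r powr (- ((\<sigma> + 1) * (p - 1)))"
    using flux_decay_subquadratic[OF assms C0(2)] by blast
  define K1 where "K1 = L * (1 + \<bar>\<alpha> - n\<bar> / (\<sigma>0 - \<alpha>))"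
  define K0 where "K0 = C0 powr q / (\<delta> - \<alpha>)"
  have K: "K0 \<ge> 0" "K1 \<ge> 0" using \<delta> \<sigma>0 L by (auto simp: K0_def K1_def)
  have improve: "\<bar>w r\<bar> \<le> (K1 * C powr (p - 1) + K0) * r powr (- \<sigma>)"
    if \<sigma>: "\<sigma>0 \<le> \<sigma>" "\<sigma> < \<delta>" and C: "C \<ge> 1" and w: "\<And>r. r \<ge> a \<Longrightarrow> \<bar>w r\<bar> \<le> C * r powr (- \<sigma>)"
      and r: "r \<ge> a" for \<sigma> C r
  proof -
    define k where "k = (\<sigma> + 1) * (p - 1)"
    have k: "k + 1 > \<sigma>" using sub[OF \<sigma>(2)] by (simp add: k_def algebra_simps)
    have "\<bar>w r\<bar> \<le> L * C powr (p - 1) * (1 + \<bar>\<alpha> - n\<bar> / (k + 1 - \<alpha>)) * r powr (- (k + 1))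
        + K0 * r powr (- \<delta>)"
      unfolding K0_def
    proof (rule w_le_of_flux_le[OF C0(2) _ wq])
      show "\<bar>\<phi> s\<bar> \<le> L * C powr (p - 1) * s powr (- k)" if "s \<ge> a" for s
        unfolding k_def using \<sigma> \<sigma>0 \<alpha> sub[OF \<sigma>(2)] C w that by (intro flux_le) auto
    qed (use k \<sigma> \<sigma>0 \<delta> r in auto)
    also have "L * C powr (p - 1) * (1 + \<bar>\<alpha> - n\<bar> / (k + 1 - \<alpha>)) * r powr (- (k + 1))
        \<le> L * C powr (p - 1) * (1 + \<bar>\<alpha> - n\<bar> / (\<sigma>0 - \<alpha>)) * r powr (- \<sigma>)"
      using L k \<sigma> \<sigma>0 r a1 C by (intro mult_mono powr_mono add_mono divide_left_mono) auto
    also have "K0 * r powr (- \<delta>) \<le> K0 * r powr (- \<sigma>)"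
      using K \<sigma> r a1 by (intro mult_left_mono powr_mono) auto
    finally show ?thesis by (simp add: K1_def algebra_simps)
  qed
  \<comment> \<open>The inequality \<open>C \<le> (1 + K0 + K1) * C powr (p - 1)\<close> forces
    \<open>C powr (2 - p) \<le> 1 + K0 + K1\<close>, that is, \<open>C \<le> M\<close>.\<close>
  define M where "M = (1 + K0 + K1) powr (1 / (2 - p))"
  have M: "\<bar>w r\<bar> \<le> M * r powr (- \<sigma>)" if \<sigma>: "\<sigma>0 \<le> \<sigma>" "\<sigma> < \<delta>" and r: "r \<ge> a" for \<sigma> r
  proof -
    obtain C1 b where C1: "C1 \<ge> 1" "b \<ge> R" "\<And>r. r \<ge> b \<Longrightarrow> \<bar>w r\<bar> \<le> C1 * r powr (- \<sigma>)"
      using decays_subcritical[OF sub[OF \<sigma>(2)]] by (elim decays_E) blast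
    \<comment> \<open>Finiteness of the best constant: beyond \<open>b\<close> by the subcritical
      rate, between \<open>a\<close> and \<open>b\<close> by
      \<open>\<bar>w r\<bar> \<le> 1\<close>.\<close>
    have "\<bar>w r\<bar> * r powr \<sigma> \<le> max C1 (b powr \<sigma>)" if "r \<ge> a" for r
    proof (cases "r \<ge> b")
      case True
      then show ?thesis using C1(3)[OF True] that a1 by (simp add: powr_minus field_simps)
    next
      case False
      have "\<bar>w r\<bar> * r powr \<sigma> \<le> 1 * b powr \<sigma>"
        using False that C0(2) w_le_1[of r] \<sigma> \<sigma>0 \<alpha> a1 by (intro mult_mono powr_mono2) auto
      then show ?thesis by simp
    qed
    then have bdd: "bdd_above ((\<lambda>r. \<bar>w r\<bar> * r powr \<sigma>) ` {a..})" by (auto simp: bdd_above_def)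
    define S where "S = (SUP r\<in>{a..}. \<bar>w r\<bar> * r powr \<sigma>)"
    define C where "C = max 1 S"
    have S: "\<bar>w r\<bar> * r powr \<sigma> \<le> S" if "r \<ge> a" for r
      unfolding S_def using that by (intro cSUP_upper[OF _ bdd]) auto
    have w: "\<bar>w r\<bar> \<le> C * r powr (- \<sigma>)" if "r \<ge> a" for r
      using S[OF that] that a1 by (simp add: C_def powr_minus field_simps)
    have C: "C \<ge> 1" by (simp add: C_def)
    have "S \<le> K1 * C powr (p - 1) + K0"
      unfolding S_def
    proof (rule cSUP_least)
      fix r assume "r \<in> {a..}"
      then show "\<bar>w r\<bar> * r powr \<sigma> \<le> K1 * C powr (p - 1) + K0"
        using improve[OF \<sigma> C w, of r] a1 by (simp add: powr_minus field_simps)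
    qed auto
    moreover have C1: "1 \<le> C powr (p - 1)" using C p by (intro ge_one_powr_ge_zero) auto
    moreover have "K0 \<le> K0 * C powr (p - 1)" using mult_left_mono[OF C1 K(1)] by simp
    moreover have "K1 * C powr (p - 1) \<ge> 0" using K by simp
    ultimately have "S \<le> (1 + K0 + K1) * C powr (p - 1)" "1 \<le> (1 + K0 + K1) * C powr (p - 1)"
      unfolding distrib_right using K by linarith+
    then have "C \<le> (1 + K0 + K1) * C powr (p - 1)" by (subst C_def) simp
    moreover have "C = C powr (p - 1) * C powr (2 - p)" using C by (simp flip: powr_add)
    ultimately have "C powr (p - 1) * C powr (2 - p) \<le> C powr (p - 1) * (1 + K0 + K1)"
      by (simp add: mult.commute)
    then have "C powr (2 - p) \<le> 1 + K0 + K1" using C by simp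
    then have "(C powr (2 - p)) powr (1 / (2 - p)) \<le> M"
      unfolding M_def using assms by (intro powr_mono2) auto
    then have "C \<le> M" using C assms by (simp add: powr_powr)
    then show ?thesis using w[OF r] mult_right_mono[of C M "r powr (- \<sigma>)"] by simp
  qed
  \<comment> \<open>\<open>M\<close> and \<open>a\<close> do not depend on \<sigma>, so \<sigma> may
    tend to \<delta> from the left at fixed \<open>r\<close>.\<close>
  have "\<bar>w r\<bar> \<le> M * r powr (- \<delta>)" if r: "r \<ge> a" for r
  proof (rule tendsto_lowerbound)
    show "((\<lambda>\<sigma>. M * r powr (- \<sigma>)) \<longlongrightarrow> M * r powr (- \<delta>)) (at_left \<delta>)"
      using r a1 by (intro tendsto_intros) auto
    show "\<forall>\<^sub>F \<sigma> in at_left \<delta>. \<bar>w r\<bar> \<le> M * r powr (- \<sigma>)"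
      using eventually_at_left_real[OF \<sigma>0(2)] by eventually_elim (use M r in auto)
  qed simp
  then show ?thesis unfolding \<delta>_def eventually_at_top_linorder by blast
qed

subsection \<open>Extinction for \<open>p > 2\<close>\<close>

text \<open>The first term equals \<open>(p - 1) / p * \<bar>w'\<bar> powr p\<close>; the others
  form a potential for \<open>\<alpha> w + \<bar>w\<bar> powr (q - 1) * w\<close>. It is written in
  \<phi> because \<phi>, unlike \<open>w'\<close>, comes with a derivative.\<close>

definition energy :: "real \<Rightarrow> real" where
  "energy r = (p - 1) / p * \<bar>\<phi> r\<bar> powr (p / (p - 1)) + \<alpha> / 2 * (w r)\<^sup>2 + \<bar>w r\<bar> powr (q + 1) / (q + 1)"

lemma energy_nonneg: "energy r \<ge> 0"
  unfolding energy_def using p q \<alpha> by (intro add_nonneg_nonneg mult_nonneg_nonneg divide_nonneg_nonneg) auto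

lemma energy_ge:
  shows "(p - 1) / p * \<bar>\<phi> r\<bar> powr (p / (p - 1)) \<le> energy r" and "\<alpha> / 2 * (w r)\<^sup>2 \<le> energy r"
proof -
  have "(p - 1) / p * \<bar>\<phi> r\<bar> powr (p / (p - 1)) \<ge> 0" "\<alpha> / 2 * (w r)\<^sup>2 \<ge> 0" "\<bar>w r\<bar> powr (q + 1) / (q + 1) \<ge> 0"
    using p q \<alpha> by auto
  then show "(p - 1) / p * \<bar>\<phi> r\<bar> powr (p / (p - 1)) \<le> energy r" "\<alpha> / 2 * (w r)\<^sup>2 \<le> energy r"
    unfolding energy_def by linarith+
qed

text \<open>This is the equation multiplied by \<open>w'\<close>: the derivative of the first energy
  term is \<open>v * \<phi>'\<close>.\<close>

lemma energy_deriv: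
  assumes r: "r \<ge> R"
  shows "(energy has_real_derivative - ((n - 1) / r * (\<phi> r * v r)) - r * (v r)\<^sup>2) (at r)"
proof -
  have 1: "((\<lambda>r. \<bar>\<phi> r\<bar> powr (p / (p - 1))) has_real_derivative p / (p - 1) * v r * \<phi>' r) (at r)"
  proof -
    have "p / (p - 1) > 1" "p / (p - 1) - 1 = 1 / (p - 1)" using p by (auto simp: field_simps)
    then show ?thesis
      using DERIV_chain2[OF has_real_derivative_abs_powr flux_deriv[OF r], of "p / (p - 1)"] v_eq[of r] by simp
  qed
  have "sgn (w r) * \<bar>w r\<bar> powr q = \<bar>w r\<bar> powr (q - 1) * w r"
    using powr_add[of "\<bar>w r\<bar>" "q - 1" 1] by (cases "w r = 0") (auto simp: sgn_if)
  then have 2: "((\<lambda>r. \<bar>w r\<bar> powr (q + 1)) has_real_derivative (q + 1) * (\<bar>w r\<bar> powr (q - 1) * w r) * v r) (at r)"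
    using DERIV_chain2[OF has_real_derivative_abs_powr w_deriv[OF r], of "q + 1"] q by simp
  have 3: "((\<lambda>r. \<alpha> / 2 * (w r)\<^sup>2) has_real_derivative \<alpha> * w r * v r) (at r)"
    by (auto intro!: derivative_eq_intros w_deriv[OF r])
  have "(energy has_real_derivative (p - 1) / p * (p / (p - 1) * v r * \<phi>' r) + \<alpha> * w r * v r
      + \<bar>w r\<bar> powr (q - 1) * w r * v r) (at r)"
    unfolding energy_def[abs_def]
    using DERIV_add[OF DERIV_add[OF DERIV_cmult[OF 1, of "(p - 1) / p"] 3] DERIV_cdivide[OF 2, of "q + 1"]]
      p q by (simp add: mult.assoc)
  moreover have "(p - 1) / p * (p / (p - 1) * v r * \<phi>' r) = v r * \<phi>' r" using p by simp
  moreover have "v r * \<phi>' r + \<alpha> * w r * v r + \<bar>w r\<bar> powr (q - 1) * w r * v r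
      = - ((n - 1) / r * (\<phi> r * v r)) - r * (v r)\<^sup>2"
    using arg_cong[OF ode[OF r], of "\<lambda>x. v r * x"] by (simp add: algebra_simps power2_eq_square)
  ultimately show ?thesis by simp
qed

lemma energy_deriv_le:
  assumes r: "r \<ge> R"
  shows "- ((n - 1) / r * (\<phi> r * v r)) - r * (v r)\<^sup>2 \<le> - (v r)\<^sup>2"
proof -
  have "\<phi> r * v r = \<bar>v r\<bar> powr (p - 2) * (v r)\<^sup>2" by (simp add: flux power2_eq_square)
  then have "(n - 1) / r * (\<phi> r * v r) \<ge> 0" using n r R by simp
  moreover have "1 * (v r)\<^sup>2 \<le> r * (v r)\<^sup>2" using r R by (intro mult_right_mono) auto
  ultimately show ?thesis by linarith
qed

lemma energy_antimono:
  assumes "R \<le> r" "r \<le> s"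
  shows "energy s \<le> energy r"
proof (rule DERIV_nonpos_imp_nonincreasing[OF assms(2)])
  fix x assume "r \<le> x"
  then show "\<exists>y. DERIV energy x :> y \<and> y \<le> 0"
    using energy_deriv[of x] energy_deriv_le[of x] assms
    by (smt (verit) zero_le_power2)
qed

text \<open>For \<open>p > 2\<close> every rate is subcritical for \<open>w\<close>, and the flux
  decays at least as fast. All exponents in the energy are at least 1, so each term is bounded by a
  first power once \<phi> and \<open>w\<close> are at most 1.\<close>

lemma energy_decay:
  assumes "p > 2" and M: "M > 0"
  shows "\<exists>C. \<forall>\<^sub>F r in at_top. energy r \<le> C * r powr (- M)"
proof -
  have neg: "(2 - p) * (M + 1) < 2"
    using assms mult_nonpos_nonneg[of "2 - p" "M + 1"] by simp
  obtain C a where C: "C \<ge> 1" "a \<ge> R" "\<And>r. r \<ge> a \<Longrightarrow> \<bar>w r\<bar> \<le> C * r powr (- M)"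
    using decays_subcritical[OF neg] by (elim decays_E) blast
  define k where "k = (M + 1) * (p - 1)"
  have k: "k \<ge> M" 
  proof -
    have "M \<le> (M + 1) * 1" by simp
    also have "\<dots> \<le> (M + 1) * (p - 1)" using assms by (intro mult_left_mono) auto
    finally show ?thesis unfolding k_def .
  qed
  obtain B where B: "\<forall>\<^sub>F r in at_top. \<bar>\<phi> r\<bar> \<le> B * r powr (- k)"
    using flux_decay[OF decays_subcritical[OF neg] M neg] unfolding k_def by blast
  have "((\<lambda>r. B * r powr (- k)) \<longlongrightarrow> 0) at_top" by (rule tendsto_mult_powr_neg) (use k M in simp)
  then have small: "\<forall>\<^sub>F r in at_top. B * r powr (- k) < 1" by (rule order_tendstoD) simp
  have "\<forall>\<^sub>F r in at_top. energy r \<le> (\<bar>B\<bar> + (\<alpha> + 1) * C) * r powr (- M)"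
    using B small eventually_ge_at_top[of a]
  proof eventually_elim
    case (elim r)
    have r1: "r \<ge> 1" using elim C R by simp
    have w1: "\<bar>w r\<bar> \<le> 1" using elim C by (intro w_le_1) auto
    have pp: "p / (p - 1) \<ge> 1" "(p - 1) / p \<le> 1" using p by auto
    have "\<bar>\<phi> r\<bar> powr (p / (p - 1)) \<le> \<bar>\<phi> r\<bar> powr 1"
      using elim pp by (intro powr_mono') auto
    also have "\<dots> \<le> B * r powr (- k)" using elim by simp
    also have "\<dots> \<le> \<bar>B\<bar> * r powr (- M)" using r1 k by (intro mult_mono powr_mono) auto
    finally have 1: "\<bar>\<phi> r\<bar> powr (p / (p - 1)) \<le> \<bar>B\<bar> * r powr (- M)" .
    have "(p - 1) / p * \<bar>\<phi> r\<bar> powr (p / (p - 1)) \<le> 1 * \<bar>\<phi> r\<bar> powr (p / (p - 1))"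
      using pp by (intro mult_right_mono) auto
    then have 2: "(p - 1) / p * \<bar>\<phi> r\<bar> powr (p / (p - 1)) \<le> \<bar>B\<bar> * r powr (- M)" using 1 by simp
    have "(w r)\<^sup>2 \<le> \<bar>w r\<bar>" using w1 power_decreasing[of 1 2 "\<bar>w r\<bar>"] by simp
    then have 3: "\<alpha> / 2 * (w r)\<^sup>2 \<le> \<alpha> * \<bar>w r\<bar>" using \<alpha> by (intro mult_mono) auto
    have "\<bar>w r\<bar> powr (q + 1) \<le> \<bar>w r\<bar> powr 1" using w1 q by (intro powr_mono') auto
    then have "\<bar>w r\<bar> powr (q + 1) / (q + 1) \<le> \<bar>w r\<bar> / 1" using q by (intro frac_le) auto
    with 2 3 have "energy r \<le> \<bar>B\<bar> * r powr (- M) + (\<alpha> + 1) * \<bar>w r\<bar>"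
      by (simp add: energy_def algebra_simps)
    also have "(\<alpha> + 1) * \<bar>w r\<bar> \<le> (\<alpha> + 1) * (C * r powr (- M))"
      using C(3)[of r] elim \<alpha> by (intro mult_left_mono) auto
    finally show ?case by (simp add: algebra_simps)
  qed
  then show ?thesis by blast
qed

text \<open>
  The energy at \<open>r\<close> controls the flux and \<open>w\<close> on the whole half-line beyond \<open>r\<close>, so integrating
  \<open>J'\<close> from infinity bounds \<open>\<bar>w r\<bar>\<close> by \<open>\<bar>\<phi> r\<bar>\<close> up to a term of higher order than \<open>energy r powr (1 / 2)\<close>.
\<close>
lemma w_le_flux_energy:
  assumes "p > 2"
  shows "\<exists>e>0. \<exists>c\<ge>0. \<forall>\<^sub>F r in at_top. \<bar>w r\<bar> \<le> \<bar>\<phi> r\<bar> + c * energy r powr (1 / 2 + e)"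
proof -
  \<comment> \<open>The energy \<open>E\<close> bounds \<open>\<bar>\<phi>\<bar>\<close> by
    \<open>E powr ((p - 1) / p)\<close> and \<open>\<bar>w\<bar> powr q\<close> by
    \<open>E powr (q / 2)\<close>, up to constants. Both exponents exceed 1/2 by at least
    \<open>2 * e\<close>: one \<open>e\<close> is spent on integrability, the other is kept.\<close>
  define e where "e = min ((p - 2) / (4 * p)) ((q - 1) / 4)"
  have e: "e > 0" using assms q by (simp add: e_def)
  have "e \<le> (p - 2) / (4 * p)" "e \<le> (q - 1) / 4" unfolding e_def by (rule min.cobounded1, rule min.cobounded2)
  then have "2 * e \<le> (p - 2) / (2 * p)" "2 * e \<le> (q - 1) / 2" by simp_all
  moreover have "(p - 1) / p = 1 / 2 + (p - 2) / (2 * p)" using p by (simp add: field_simps)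
  moreover have "q / 2 = 1 / 2 + (q - 1) / 2" by (simp add: field_simps)
  ultimately have exps: "1 / 2 + 2 * e \<le> (p - 1) / p" "1 / 2 + 2 * e \<le> q / 2" by simp_all
  \<comment> \<open>With this rate \<open>energy s powr e\<close> is of order
    \<open>s powr (- (\<alpha> + 1))\<close>, which turns the weight
    \<open>s powr (\<alpha> - 1)\<close> into the integrable \<open>s powr (- 2)\<close>.\<close>
  define M where "M = (\<alpha> + 1) / e"
  have M: "M > 0" "M * e = \<alpha> + 1" using e \<alpha> by (auto simp: M_def)
  obtain C where C: "\<forall>\<^sub>F r in at_top. energy r \<le> C * r powr (- M)"
    using energy_decay[OF assms M(1)] by blast
  have "((\<lambda>r. C * r powr (- M)) \<longlongrightarrow> 0) at_top" by (rule tendsto_mult_powr_neg[OF M(1)])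
  then have "\<forall>\<^sub>F r in at_top. C * r powr (- M) < 1" by (rule order_tendstoD) simp
  with C have "\<forall>\<^sub>F r in at_top. energy r \<le> C * r powr (- M) \<and> energy r \<le> 1"
    by eventually_elim auto
  then obtain a0 where a0: "\<And>r. r \<ge> a0 \<Longrightarrow> energy r \<le> C * r powr (- M) \<and> energy r \<le> 1"
    by (auto simp: eventually_at_top_linorder)
  define a where "a = max a0 R"
  have a: "a \<ge> 1" "a \<ge> R" using R by (auto simp: a_def)
  have E1: "energy r \<le> C * r powr (- M)" "energy r \<le> 1" if "r \<ge> a" for r
    using a0[of r] that by (auto simp: a_def)
  have "0 \<le> C * a powr (- M)" using E1(1)[of a] energy_nonneg[of a] by linarith
  then have C0: "C \<ge> 0" using a by (simp add: zero_le_mult_iff)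
  define c1 where "c1 = (p / (p - 1)) powr ((p - 1) / p)"
  define c2 where "c2 = (2 / \<alpha>) powr (q / 2)"
  have c12: "c1 \<ge> 0" "c2 \<ge> 0" by (auto simp: c1_def c2_def)
  have \<phi>_le: "\<bar>\<phi> r\<bar> \<le> c1 * energy r powr (1 / 2 + 2 * e)" if "r \<ge> a" for r
  proof -
    have "\<bar>\<phi> r\<bar> = (\<bar>\<phi> r\<bar> powr (p / (p - 1))) powr ((p - 1) / p)" using p by (simp add: powr_powr)
    also have "\<dots> \<le> (p / (p - 1) * energy r) powr ((p - 1) / p)"
      using energy_ge(1)[of r] p by (intro powr_mono2) (auto simp: field_simps)
    also have "\<dots> = c1 * energy r powr ((p - 1) / p)"
      unfolding c1_def using p energy_nonneg by (subst powr_mult) auto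
    also have "\<dots> \<le> c1 * energy r powr (1 / 2 + 2 * e)"
      using exps E1(2)[OF that] energy_nonneg c12 by (intro mult_left_mono powr_mono') auto
    finally show ?thesis .
  qed
  have w_le: "\<bar>w r\<bar> powr q \<le> c2 * energy r powr (1 / 2 + 2 * e)" if "r \<ge> a" for r
  proof -
    have "(w r)\<^sup>2 = \<bar>w r\<bar> powr 2" by (cases "w r = 0") (simp_all add: powr_numeral)
    then have "\<bar>w r\<bar> powr q = ((w r)\<^sup>2) powr (q / 2)" by (simp only: powr_powr) simp
    also have "\<dots> \<le> (2 / \<alpha> * energy r) powr (q / 2)"
      using energy_ge(2)[of r] \<alpha> q by (intro powr_mono2) (auto simp: field_simps)
    also have "\<dots> = c2 * energy r powr (q / 2)"
      unfolding c2_def using \<alpha> energy_nonneg by (subst powr_mult) auto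
    also have "\<dots> \<le> c2 * energy r powr (1 / 2 + 2 * e)"
      using exps E1(2)[OF that] energy_nonneg c12 by (intro mult_left_mono powr_mono') auto
    finally show ?thesis .
  qed
  define c where "c = (\<bar>\<alpha> - n\<bar> * c1 + c2) * C powr e"
  have c0: "c \<ge> 0" using c12 by (simp add: c_def)
  have "\<bar>w r\<bar> \<le> \<bar>\<phi> r\<bar> + c * energy r powr (1 / 2 + e)" if r: "r \<ge> a" for r
  proof -
    have r1: "r \<ge> 1" using r a by simp
    define X where "X = energy r powr (1 / 2 + e)"
    \<comment> \<open>Monotonicity of the energy freezes the factor with exponent
      \<open>1 / 2 + e\<close> at \<open>r\<close>; the remaining power \<open>e\<close> supplies
      the decay in \<open>s\<close>.\<close>
    have split: "energy s powr (1 / 2 + 2 * e) \<le> X * (C powr e * s powr (- (\<alpha> + 1)))" if s: "s \<ge> r" for s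
    proof -
      have "energy s powr (1 / 2 + 2 * e) = energy s powr (1 / 2 + e) * energy s powr e"
        by (simp add: add.commute flip: powr_add)
      also have "\<dots> \<le> X * (C * s powr (- M)) powr e"
        unfolding X_def using s r a e E1(1)[of s] energy_antimono[of r s] energy_nonneg
        by (intro mult_mono powr_mono2) auto
      also have "(C * s powr (- M)) powr e = C powr e * s powr (- (\<alpha> + 1))"
        using C0 M by (simp add: powr_mult powr_powr)
      finally show ?thesis .
    qed
    have "\<bar>J r\<bar> \<le> c * X / 1 * r powr (- 1)"
    proof (rule abs_le_of_abs_deriv_le[of r J _ "\<lambda>s. c * X / 1 * s powr (- 1)" "\<lambda>s. c * X * s powr (- 2)"])
      fix s assume s: "s \<ge> r"
      then have s1: "s \<ge> 1" and sa: "s \<ge> a" using r1 r by auto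
      show "(J has_real_derivative
          (\<alpha> - n) * s powr (\<alpha> - 2) * \<phi> s - s powr (\<alpha> - 1) * (\<bar>w s\<bar> powr (q - 1) * w s)) (at s)"
        by (rule J_deriv) (use s r a in auto)
      show "((\<lambda>s. c * X / 1 * s powr (- 1)) has_real_derivative - (c * X * s powr (- 2))) (at s)"
        using has_real_derivative_mult_powr_neg[of 1 s "c * X"] s1 by simp
      define Y where "Y = energy s powr (1 / 2 + 2 * e)"
      have "s powr (\<alpha> - 2) * \<bar>\<phi> s\<bar> \<le> s powr (\<alpha> - 1) * (c1 * Y)"
        unfolding Y_def using \<phi>_le[OF sa] s1 by (intro mult_mono powr_mono) auto
      then have 1: "\<bar>\<alpha> - n\<bar> * (s powr (\<alpha> - 2) * \<bar>\<phi> s\<bar>) \<le> \<bar>\<alpha> - n\<bar> * (s powr (\<alpha> - 1) * (c1 * Y))"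
        by (intro mult_left_mono) auto
      have 2: "s powr (\<alpha> - 1) * \<bar>w s\<bar> powr q \<le> s powr (\<alpha> - 1) * (c2 * Y)"
        unfolding Y_def using w_le[OF sa] by (intro mult_left_mono) auto
      have "\<bar>(\<alpha> - n) * s powr (\<alpha> - 2) * \<phi> s - s powr (\<alpha> - 1) * (\<bar>w s\<bar> powr (q - 1) * w s)\<bar>
          \<le> \<bar>\<alpha> - n\<bar> * (s powr (\<alpha> - 1) * (c1 * Y)) + s powr (\<alpha> - 1) * (c2 * Y)"
        using abs_J_deriv_le[of s] add_mono[OF 1 2] by (rule order_trans)
      also have "\<dots> = (\<bar>\<alpha> - n\<bar> * c1 + c2) * s powr (\<alpha> - 1) * Y" by (simp add: algebra_simps)
      also have "\<dots> \<le> (\<bar>\<alpha> - n\<bar> * c1 + c2) * s powr (\<alpha> - 1) * (X * (C powr e * s powr (- (\<alpha> + 1))))"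
        unfolding Y_def using split[OF s] c12 by (intro mult_left_mono) auto
      also have "\<dots> = c * X * (s powr (\<alpha> - 1) * s powr (- (\<alpha> + 1)))"
        unfolding c_def by (simp only: ac_simps)
      also have "s powr (\<alpha> - 1) * s powr (- (\<alpha> + 1)) = s powr (- 2)"
        unfolding powr_add[symmetric] by (rule arg_cong[where f = "\<lambda>x. s powr x"]) simp
      finally show "\<bar>(\<alpha> - n) * s powr (\<alpha> - 2) * \<phi> s - s powr (\<alpha> - 1) * (\<bar>w s\<bar> powr (q - 1) * w s)\<bar>
          \<le> c * X * s powr (- 2)" .
    next
      show "((\<lambda>s. c * X / 1 * s powr (- 1)) \<longlongrightarrow> 0) at_top" by (rule tendsto_mult_powr_neg) simp
    qed (rule J_tendsto_0)
    also have "\<dots> \<le> c * X" using r1 c0 mult_left_mono[of "r powr (- 1)" 1 "c * X"]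
      by (simp add: X_def powr_minus field_simps)
    finally have "r powr (- \<alpha>) * \<bar>J r\<bar> \<le> 1 * (c * X)"
      using r1 \<alpha> powr_mono[of "- \<alpha>" 0 r] by (intro mult_mono) auto
    moreover have "\<bar>\<phi> r\<bar> / r \<le> \<bar>\<phi> r\<bar>" using r1 divide_left_mono[of 1 r "\<bar>\<phi> r\<bar>"] by simp
    ultimately show ?thesis using abs_w_le_J[of r] r a unfolding X_def by simp
  qed
  then show ?thesis using e c0 unfolding eventually_at_top_linorder by blast
qed

text \<open>Inserting the bound on \<open>w\<close> into the energy produces multiples of
  \<open>\<bar>v r\<bar> powr p\<close> and a term of order
  \<open>energy r powr (1 + 2 * e)\<close>, which is eventually absorbed by the energy
  itself.\<close>

lemma energy_le_v_powr:
  assumes "p > 2"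
  shows "\<exists>c>0. \<forall>\<^sub>F r in at_top. energy r \<le> c * \<bar>v r\<bar> powr p"
proof -
  obtain e c where e: "e > 0" and c: "c \<ge> 0"
    and w: "\<forall>\<^sub>F r in at_top. \<bar>w r\<bar> \<le> \<bar>\<phi> r\<bar> + c * energy r powr (1 / 2 + e)"
    using w_le_flux_energy[OF assms] by blast
  obtain C where C: "\<forall>\<^sub>F r in at_top. energy r \<le> C * r powr (- 1)"
    using energy_decay[OF assms, of 1] by auto
  have E0: "(energy \<longlongrightarrow> 0) at_top"
    by (rule Lim_null_comparison[OF _ tendsto_mult_powr_neg[of 1 C]]) (use C energy_nonneg in auto)
  have "((\<lambda>r. 2 * (\<alpha> + 1) * c\<^sup>2 * energy r powr (2 * e)) \<longlongrightarrow> 2 * (\<alpha> + 1) * c\<^sup>2 * 0) at_top"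
    by (intro tendsto_mult tendsto_const tendsto_zero_powrI[OF E0 tendsto_const]) (use e energy_nonneg in auto)
  then have small: "\<forall>\<^sub>F r in at_top. 2 * (\<alpha> + 1) * c\<^sup>2 * energy r powr (2 * e) < 1 / 2"
    by (rule order_tendstoD) simp
  \<comment> \<open>This threshold forces \<open>\<bar>\<phi> r\<bar> \<le> 1\<close>; then
    \<open>p / (p - 1) \<le> 2\<close> bounds the square of the flux by \<open>V\<close>.\<close>
  have "\<forall>\<^sub>F r in at_top. energy r < (p - 1) / p"
    by (rule order_tendstoD[OF E0]) (use p in simp)
  with w small eventually_ge_at_top[of R]
  have "\<forall>\<^sub>F r in at_top. energy r \<le> 2 * (1 + 2 * (\<alpha> + 1)) * \<bar>v r\<bar> powr p"
  proof eventually_elim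
    case (elim r)
    define V where "V = \<bar>\<phi> r\<bar> powr (p / (p - 1))"
    have V: "V = \<bar>v r\<bar> powr p" using p by (simp add: V_def abs_flux powr_powr)
    have pp: "0 < p / (p - 1)" "p / (p - 1) \<le> 2" "(p - 1) / p \<le> 1" "(p - 1) / p > 0"
      using assms by (auto simp: field_simps)
    have "(p - 1) / p * V < (p - 1) / p * 1" using energy_ge(1)[of r] elim unfolding V_def by linarith
    then have "V < 1" using pp by (simp only: mult_less_cancel_left_pos)
    then have \<phi>1: "\<bar>\<phi> r\<bar> \<le> 1"
      using pp(1) gr_one_powr[of "\<bar>\<phi> r\<bar>" "p / (p - 1)"] unfolding V_def by argo
    have \<phi>2: "(\<phi> r)\<^sup>2 \<le> V"
    proof -
      have "\<bar>\<phi> r\<bar> powr 2 \<le> V" unfolding V_def using \<phi>1 pp by (intro powr_mono') auto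
      then show ?thesis by (cases "\<phi> r = 0") (auto simp: powr_numeral V_def)
    qed
    have w1: "\<bar>w r\<bar> \<le> 1" using elim by (intro w_le_1) auto
    have "\<bar>w r\<bar> powr (q + 1) \<le> \<bar>w r\<bar> powr 2" using w1 q by (intro powr_mono') auto
    also have "\<bar>w r\<bar> powr 2 = (w r)\<^sup>2" by (cases "w r = 0") (auto simp: powr_numeral)
    finally have "\<bar>w r\<bar> powr (q + 1) / (q + 1) \<le> (w r)\<^sup>2 / 1" using q by (intro frac_le) auto
    moreover have "(p - 1) / p * V \<le> 1 * V" using pp by (intro mult_right_mono) (auto simp: V_def)
    moreover have "\<alpha> / 2 * (w r)\<^sup>2 \<le> \<alpha> * (w r)\<^sup>2" using \<alpha> by (intro mult_right_mono) auto
    ultimately have E: "energy r \<le> V + (\<alpha> + 1) * (w r)\<^sup>2"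
      unfolding energy_def V_def[symmetric] by (simp add: algebra_simps)
    define X where "X = c * energy r powr (1 / 2 + e)"
    have "(w r)\<^sup>2 \<le> (\<bar>\<phi> r\<bar> + X)\<^sup>2"
      using elim unfolding X_def by (intro power2_le_iff_abs_le[THEN iffD2]) auto
    also have "\<dots> \<le> 2 * (\<phi> r)\<^sup>2 + 2 * X\<^sup>2"
      using sum_squares_ge_zero[of "\<bar>\<phi> r\<bar> - X" 0] by (simp add: power2_eq_square algebra_simps)
    also have "X\<^sup>2 = c\<^sup>2 * (energy r powr (2 * e) * energy r)"
    proof -
      have "(energy r powr (1 / 2 + e))\<^sup>2 = energy r powr (2 * e + 1)"
        by (simp add: power2_eq_square add.commute flip: powr_add)
      also have "\<dots> = energy r powr (2 * e) * energy r"
        using energy_nonneg[of r] by (simp add: powr_add)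
      finally show ?thesis by (simp add: X_def power_mult_distrib)
    qed
    finally have "(\<alpha> + 1) * (w r)\<^sup>2 \<le> (\<alpha> + 1) * (2 * V + 2 * (c\<^sup>2 * (energy r powr (2 * e) * energy r)))"
      using \<alpha> \<phi>2 by (intro mult_left_mono) auto
    also have "\<dots> = 2 * (\<alpha> + 1) * V + 2 * (\<alpha> + 1) * c\<^sup>2 * energy r powr (2 * e) * energy r"
      by (simp add: algebra_simps)
    also have "2 * (\<alpha> + 1) * c\<^sup>2 * energy r powr (2 * e) * energy r \<le> 1 / 2 * energy r"
      using elim energy_nonneg by (intro mult_right_mono) auto
    finally have "energy r \<le> V + 2 * (\<alpha> + 1) * V + 1 / 2 * energy r" using E by linarith
    then have "energy r \<le> 2 * (1 + 2 * (\<alpha> + 1)) * V" by (simp add: algebra_simps)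
    then show ?case by (simp add: V)
  qed
  then show ?thesis using \<alpha> by (intro exI[of _ "2 * (1 + 2 * (\<alpha> + 1))"]) auto
qed

text \<open>A positive energy would satisfy \<open>E' \<le> - d * E powr (2 / p)\<close> with
  \<open>2 / p < 1\<close>, so it vanishes somewhere. Being nonnegative and nonincreasing, it stays
  zero, and it dominates a multiple of the square of \<open>w\<close>.\<close>

lemma compact_support_superquadratic:
  assumes "p > 2"
  shows "\<forall>\<^sub>F r in at_top. w r = 0"
proof -
  obtain c where c: "c > 0" and "\<forall>\<^sub>F r in at_top. energy r \<le> c * \<bar>v r\<bar> powr p"
    using energy_le_v_powr[OF assms] by blast
  then obtain a0 where a0: "\<And>r. r \<ge> a0 \<Longrightarrow> energy r \<le> c * \<bar>v r\<bar> powr p"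
    by (auto simp: eventually_at_top_linorder)
  define a where "a = max a0 R"
  define d where "d = (1 / c) powr (2 / p)"
  have "\<exists>r\<ge>a. energy r = 0"
  proof (rule ccontr)
    assume "\<not> ?thesis"
    then have pos: "energy r > 0" if "r \<ge> a" for r using that energy_nonneg[of r] by force
    show False
    proof (rule no_positive_solution_of_sublinear_decay[of a energy _ d "2 / p", OF _ pos])
      fix r assume "r \<ge> a"
      then have r: "r \<ge> R" "r \<ge> a0" by (auto simp: a_def)
      show "(energy has_real_derivative - ((n - 1) / r * (\<phi> r * v r)) - r * (v r)\<^sup>2) (at r)"
        by (rule energy_deriv[OF r(1)])
      have "d * energy r powr (2 / p) = (1 / c * energy r) powr (2 / p)"
        unfolding d_def using c energy_nonneg by (subst powr_mult) auto
      also have "\<dots> \<le> (\<bar>v r\<bar> powr p) powr (2 / p)"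
        using a0[OF r(2)] c energy_nonneg p by (intro powr_mono2) (auto simp: field_simps)
      also have "\<dots> = (v r)\<^sup>2" using p by (cases "v r = 0") (auto simp: powr_powr powr_numeral)
      finally show "- ((n - 1) / r * (\<phi> r * v r)) - r * (v r)\<^sup>2 \<le> - d * energy r powr (2 / p)"
        using energy_deriv_le[OF r(1)] by simp
    qed (use c assms in \<open>auto simp: d_def\<close>)
  qed
  then obtain b where b: "b \<ge> a" "energy b = 0" by blast
  have "w r = 0" if "r \<ge> b" for r
  proof -
    have "energy r \<le> 0" using energy_antimono[of b r] b that by (simp add: a_def)
    then have "\<alpha> / 2 * (w r)\<^sup>2 \<le> 0" using energy_ge(2)[of r] by linarith
    then show ?thesis using \<alpha> by (simp add: mult_le_0_iff)
  qed
  then show ?thesis by (auto simp: eventually_at_top_linorder)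
qed

end

theorem proposition3p2:
  fixes N :: nat and p q \<alpha> :: real and w :: "real \<Rightarrow> real"
  assumes "N \<ge> 1" and "p > 1" and "q > 1" and "\<alpha> > 0"
    and "p > 2 \<or> (p < 2 \<and> \<alpha> < delta p)"
    and "solution_E N p q \<alpha> w"
    and "((\<lambda>r. r powr \<alpha> * w r) \<longlongrightarrow> 0) at_top"
  shows "(p > 2 \<longrightarrow> (\<forall>\<^sub>F r in at_top. w r = 0)) \<and>
         (p < 2 \<longrightarrow> w \<in> O[at_top](\<lambda>r. r powr (- delta p)))"
proof -
  obtain R0 where R0: "R0 \<ge> 0" and w: "w C1_differentiable_on {R0<..}"
    and fl: "p_flux p w C1_differentiable_on {R0<..}" and ode: "\<And>r. r > R0 \<Longrightarrow> ode_E N p q \<alpha> w r"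
    using assms(6) unfolding solution_E_def by blast
  have "\<forall>\<^sub>F r in at_top. \<bar>r powr \<alpha> * w r\<bar> < 1"
    using order_tendstoD(2)[OF tendsto_rabs[OF assms(7)], of 1] by simp
  then obtain a where a: "\<And>r. r \<ge> a \<Longrightarrow> \<bar>r powr \<alpha> * w r\<bar> < 1"
    by (auto simp: eventually_at_top_linorder)
  have deriv: "(f has_real_derivative deriv f r) (at r)"
    if "f C1_differentiable_on {R0<..}" "r > R0" for f r
    using that unfolding C1_differentiable_on_def
    by (metis DERIV_imp_deriv greaterThan_iff has_real_derivative_iff_has_vector_derivative)
  \<comment> \<open>\<open>R0 + 1\<close> gives \<open>R \<ge> 1\<close> and keeps \<open>R\<close>
    inside the domain; beyond \<open>a\<close> the bound
    \<open>r powr \<alpha> * \<bar>w r\<bar> < 1\<close> with \<open>r \<ge> 1\<close> yields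
    \<open>\<bar>w r\<bar> \<le> 1\<close>.\<close>
  define R where "R = max (R0 + 1) a"
  interpret decaying_solution "real N" p q \<alpha> R w "deriv w" "p_flux p w" "deriv (p_flux p w)"
  proof
    show "(2 - p) * (\<alpha> + 1) < 2"
    proof (cases "p < 2")
      case True
      then show ?thesis using assms(5) by (simp add: delta_def field_simps)
    next
      case False
      then show ?thesis using assms mult_nonpos_nonneg[of "2 - p" "\<alpha> + 1"] by simp
    qed
    fix r assume r: "r \<ge> R"
    show "(w has_real_derivative deriv w r) (at r)" using r by (intro deriv w) (simp add: R_def)
    show "(p_flux p w has_real_derivative deriv (p_flux p w) r) (at r)"
      using r by (intro deriv fl) (simp add: R_def)
    show "deriv (p_flux p w) r + (real N - 1) / r * p_flux p w r + r * deriv w r + \<alpha> * w r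
        + \<bar>w r\<bar> powr (q - 1) * w r = 0"
      using ode[of r] r by (simp add: ode_E_def R_def)
    have "1 * \<bar>w r\<bar> \<le> r powr \<alpha> * \<bar>w r\<bar>"
      using r R0 assms(4) by (intro mult_right_mono ge_one_powr_ge_zero) (auto simp: R_def)
    then show "\<bar>w r\<bar> \<le> 1" using a[of r] r by (simp add: R_def abs_mult)
  qed (use assms R0 in \<open>auto simp: R_def p_flux_def\<close>)
  have "w \<in> O[at_top](\<lambda>r. r powr (- delta p))" if p_less: "p < 2"
  proof -
    obtain C where "\<forall>\<^sub>F r in at_top. \<bar>w r\<bar> \<le> C * r powr (- delta p)"
      using delta_decay_subquadratic[OF p_less] unfolding delta_def by blast
    then show ?thesis by (intro bigoI[of _ C]) simp
  qed
  then show ?thesis using compact_support_superquadratic by blast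
qed

end
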